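(* Let $f=\frac1n\sum_{i=1}^nf_i$ with each $f_i$ continuously differentiable, $f\ge f^\star$ for some $f^\star\in\mathbb{R}$, each $f_i$ with ${\bm L}_i$-Lipschitz gradient and $f$ with ${\bm L}$-Lipschitz gradient (${\bm L}_i,{\bm L}\in\mathbb{S}^d_{++}$). Let $p\in(0,1]$ and ${\bm D}\in\mathbb{S}^d_{++}$ satisfy $${\bm D}^{-1}\succeq\left(\frac{(1-p)R'({\bm D},\mathcal S)}{np}+1\right){\bm L},$$ where $R'({\bm D},\mathcal S)=\frac1n\sum_{i=1}^n\lambda_{\max}\!\left({\bm D}\,\mathbb{E}[{\bm T}{\bm D}^{-1}{\bm T}]\,{\bm D}-{\bm D}\right)\lambda_{\max}({\bm L}_i)\lambda_{\max}({\bm L}^{-1/2}{\bm L}_i{\bm L}^{-1/2})$ with ${\bm T}\sim\mathcal S$. Then after $K\ge1$ iterations of det-CGD2-VR, $$\mathbb{E}\left[\|\nabla f(\tilde x^K)\|^2_{{\bm D}/\det({\bm D})^{1/d}}\right]\le\frac{2(f(x^0)-f^\star)}{\det({\bm D})^{1/d}K}.$$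
   Context: Notation: $\mathbb{S}^d_{++}$ symmetric positive definite matrices; $\|x\|_{\bm M}^2:=x^\top{\bm M}x$; $\lambda_{\max}$ largest eigenvalue; a differentiable $g$ has ${\bm L}$-Lipschitz gradient if $\|\nabla g(x)-\nabla g(y)\|_{{\bm L}^{-1}}\le\|x-y\|_{\bm L}$ for all $x,y$. Sketches ${\bm T}_i^k$ are i.i.d. from a distribution $\mathcal S$ on symmetric positive semidefinite matrices with $\mathbb{E}[{\bm T}]={\bm I}_d$ and finite second moments, independent of everything else. Algorithm det-CGD2-VR (input $x^0,{\bm D},p,K$): $g^0={\bm D}\nabla f(x^0)$; for $k=0,\dots,K-1$: sample $c_k\sim\mathrm{Bernoulli}(p)$; $x^{k+1}=x^k-g^k$; for each $i$: $g_i^{k+1}={\bm D}\nabla f_i(x^{k+1})$ if $c_k=1$, else $g_i^{k+1}=g^k+{\bm T}_i^k{\bm D}(\nabla f_i(x^{k+1})-\nabla f_i(x^k))$; $g^{k+1}=\frac1n\sum_ig_i^{k+1}$. Output $\tilde x^K$ uniform from $\{x^0,\dots,x^{K-1}\}$. Expectation over all randomness. *)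

theory Defs
  imports "HOL-Probability.Probability"
begin

type_synonym 'd mat = "real^'d^'d"

definition qf :: "'d::finite mat \<Rightarrow> real^'d \<Rightarrow> real" where
  "qf M x = x \<bullet> (M *v x)"

definition mnorm :: "'d::finite mat \<Rightarrow> real^'d \<Rightarrow> real" where
  "mnorm M x = sqrt (qf M x)"

definition sym_mat :: "'d::finite mat \<Rightarrow> bool" where
  "sym_mat M \<longleftrightarrow> transpose M = M"

definition psd :: "'d::finite mat \<Rightarrow> bool" where
  "psd M \<longleftrightarrow> sym_mat M \<and> (\<forall>x. qf M x \<ge> 0)"

definition spd :: "'d::finite mat \<Rightarrow> bool" where
  "spd M \<longleftrightarrow> sym_mat M \<and> (\<forall>x. x \<noteq> 0 \<longrightarrow> qf M x > 0)"

definition loewner_ge :: "'d::finite mat \<Rightarrow> 'd mat \<Rightarrow> bool" where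
  "loewner_ge A B \<longleftrightarrow> psd (A - B)"

definition lambda_max :: "'d::finite mat \<Rightarrow> real" where
  "lambda_max M = Max {l. \<exists>v. v \<noteq> 0 \<and> M *v v = l *\<^sub>R v}"

definition msqrt :: "'d::finite mat \<Rightarrow> 'd mat" where
  "msqrt M = (THE S. psd S \<and> S ** S = M)"

definition lip_grad :: "(real^'d::finite \<Rightarrow> real^'d) \<Rightarrow> 'd mat \<Rightarrow> bool" where
  "lip_grad gr L \<longleftrightarrow>
     (\<forall>x y. mnorm (matrix_inv L) (gr x - gr y) \<le> mnorm L (x - y))"

definition avg_grad :: "nat \<Rightarrow> (nat \<Rightarrow> real^'d \<Rightarrow> real^'d) \<Rightarrow> real^'d \<Rightarrow> real^'d" where
  "avg_grad n gr x = (1 / real n) *\<^sub>R (\<Sum>i<n. gr i x)"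

text \<open>Iterates (x^k, g^k) of det-CGD2-VR as a function of the randomness
  \<omega> k = (c_k, \<lambda>i. T_i^k).\<close>
fun dcgd_state ::
  "nat \<Rightarrow> (nat \<Rightarrow> real^'d \<Rightarrow> real^'d) \<Rightarrow> 'd::finite mat \<Rightarrow> real^'d
   \<Rightarrow> (nat \<Rightarrow> bool \<times> (nat \<Rightarrow> 'd mat)) \<Rightarrow> nat \<Rightarrow> (real^'d) \<times> (real^'d)" where
  "dcgd_state n gr D x0 \<omega> 0 = (x0, D *v avg_grad n gr x0)"
| "dcgd_state n gr D x0 \<omega> (Suc k) =
     (let (x, g) = dcgd_state n gr D x0 \<omega> k;
          x' = x - g;
          c = fst (\<omega> k);
          T = snd (\<omega> k);
          gi = (\<lambda>i. if c then D *v gr i x' else g + (T i ** D) *v (gr i x' - gr i x))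
      in (x', (1 / real n) *\<^sub>R (\<Sum>i<n. gi i)))"

definition dcgd_space :: "nat \<Rightarrow> real \<Rightarrow> 'd::finite mat measure \<Rightarrow> nat
     \<Rightarrow> (nat \<Rightarrow> bool \<times> (nat \<Rightarrow> 'd mat)) measure" where
  "dcgd_space n p S K =
     (\<Pi>\<^sub>M k\<in>{..<K}. (measure_pmf (bernoulli_pmf p) \<Otimes>\<^sub>M (\<Pi>\<^sub>M i\<in>{..<n}. S)))"

end

(*
  Lyapunov argument.  Put V = |g - D grad f(x)|^2 in the D^{-1}-norm.  L-smoothness and the
  polarization of <grad f(x), g> = <D grad f(x), g>_{D^{-1}} give
    f(x - g) <= f(x) - |grad f(x)|_D^2 / 2 + V / 2 - (|g|_{D^{-1}}^2 - |g|_L^2) / 2.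
  V vanishes after a full round; after a compressed round the independent centered errors
  of the n sketches add up, so E V' <= (1 - p) (V + (R'/n) |g|_L^2).  The step-size condition
  is exactly what makes f(x) - f* + V / (2p) decrease in expectation by at least
  |grad f(x)|_D^2 / 2.  Since V = 0 initially, telescoping gives the bound.

  The bounds by lambda_max and the meaning of msqrt (a THE-description) rest on the spectral
  theorem for symmetric matrices, obtained by maximizing the Rayleigh quotient on
  invariant subspaces.
*)
theory Submission
  imports Defs
begin

section \<open>Symmetric matrices\<close>

text \<open>Expectations are nonnegative integrals in \<open>ennreal\<close>. The Lyapunov function
  is nonnegative, so no integrability of an iterate ever has to be established. Iterates are
  deterministic functions of the recorded randomness; conditioning on the past is therefore the
  inner integral over the last coordinate of a product measure, with the state frozen. The
  D^{-1}-norm does double duty. Besides polarizing the inner product, it satisfies |D y|^2 =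
  |y|_D^2, so the variance of a sketch applied to D y is exactly the quadratic form of D
  E[T D^{-1} T] D - D at y. Duality of norms and all comparisons by \<open>lambda_max\<close> reduce
  to the Euclidean case by inserting a square root and its inverse.\<close>

lemma sym_mat_inner:
  assumes "sym_mat A"
  shows "x \<bullet> (A *v y) = (A *v x) \<bullet> y"
  using assms by (metis dot_lmul_matrix sym_mat_def transpose_matrix_vector)

lemma sym_matI:
  assumes "\<And>x y. x \<bullet> (A *v y) = (A *v x) \<bullet> y"
  shows "sym_mat A"
proof -
  have "transpose A *v x = A *v x" for x
    by (rule vector_eq_rdot[THEN iffD1]) (simp add: dot_lmul_matrix assms)
  then show ?thesis
    by (simp add: sym_mat_def matrix_eq)
qed

lemma qf_add:
  assumes "sym_mat A"
  shows "qf A (x + y) = qf A x + 2 * ((A *v x) \<bullet> y) + qf A y"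
  using sym_mat_inner[OF assms, of x y]
  by (simp add: qf_def matrix_vector_right_distrib inner_add_left inner_add_right inner_commute)

lemma qf_scaleR: "qf A (c *\<^sub>R x) = c\<^sup>2 * qf A x"
  by (simp add: qf_def matrix_vector_mult_scaleR power2_eq_square)

lemma qf_minus [simp]: "qf A (- x) = qf A x"
  using qf_scaleR[of A "-1" x] by simp

lemma qf_zero [simp]: "qf A 0 = 0"
  by (simp add: qf_def)

lemma qf_diff_matrix: "qf (A - B) x = qf A x - qf B x"
  by (simp add: qf_def matrix_vector_mult_diff_rdistrib inner_diff_right)

lemma scaleR_matrix_vector: "(c *\<^sub>R A) *v x = c *\<^sub>R (A *v (x :: real^'n))"
  by (simp add: scaleR_matrix_vector_assoc)

lemma qf_scaleR_matrix: "qf (c *\<^sub>R A) x = c * qf A x"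
  by (simp add: qf_def scaleR_matrix_vector)

lemma qf_mult_sym:
  assumes "sym_mat B"
  shows "qf (B ** A ** B) x = qf A (B *v x)"
  by (simp add: qf_def matrix_vector_mul_assoc[symmetric] sym_mat_inner[OF assms])

lemma qf_square:
  assumes "sym_mat B"
  shows "qf (B ** B) x = (norm (B *v x))\<^sup>2"
  by (simp add: qf_def matrix_vector_mul_assoc[symmetric] sym_mat_inner[OF assms] power2_norm_eq_inner)

lemma spd_imp_psd: "spd A \<Longrightarrow> psd A"
  unfolding spd_def psd_def by (metis order.strict_implies_order order_refl qf_zero)

lemma sym_mat_mult: "sym_mat A \<Longrightarrow> sym_mat B \<Longrightarrow> sym_mat (B ** A ** B)"
  by (simp add: sym_mat_def matrix_transpose_mul matrix_mul_assoc)

lemma psd_congruence: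
  assumes "psd A" "sym_mat B"
  shows "psd (B ** A ** B)"
  using assms by (simp add: psd_def sym_mat_mult qf_mult_sym)

lemma sym_mat_diff: "sym_mat A \<Longrightarrow> sym_mat B \<Longrightarrow> sym_mat (A - B)"
  by (simp add: sym_mat_def transpose_def vec_eq_iff)

lemma invertible_spd:
  assumes "spd A"
  shows "invertible A"
proof -
  have "x = 0" if "A *v x = 0" for x
    using assms that by (metis inner_zero_right less_irrefl qf_def spd_def)
  then show ?thesis
    by (simp add: invertible_left_inverse matrix_left_invertible_ker)
qed

lemma matrix_inv_cancel:
  fixes A :: "'d::finite mat"
  assumes "invertible A"
  shows "A *v (matrix_inv A *v x) = x" "matrix_inv A *v (A *v x) = x"
proof -
  have "A ** matrix_inv A = mat 1 \<and> matrix_inv A ** A = mat 1"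
    using assms unfolding invertible_def matrix_inv_def by (rule someI_ex)
  then show "A *v (matrix_inv A *v x) = x" "matrix_inv A *v (A *v x) = x"
    by (simp_all add: matrix_vector_mul_assoc)
qed

lemma sym_mat_matrix_inv:
  fixes A :: "'d::finite mat"
  assumes "invertible A" "sym_mat A"
  shows "sym_mat (matrix_inv A)"
proof (rule sym_matI)
  fix x y
  have "x \<bullet> (matrix_inv A *v y) = (A *v (matrix_inv A *v x)) \<bullet> (matrix_inv A *v y)"
    by (simp add: matrix_inv_cancel assms)
  also have "\<dots> = (matrix_inv A *v x) \<bullet> (A *v (matrix_inv A *v y))"
    by (simp only: sym_mat_inner[OF assms(2)])
  also have "\<dots> = (matrix_inv A *v x) \<bullet> y"
    by (simp add: matrix_inv_cancel assms)
  finally show "x \<bullet> (matrix_inv A *v y) = (matrix_inv A *v x) \<bullet> y" .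
qed

lemma spd_matrix_inv:
  fixes A :: "'d::finite mat"
  assumes "spd A"
  shows "spd (matrix_inv A)"
  unfolding spd_def
proof (intro conjI allI impI)
  have inv: "invertible A" and sym: "sym_mat A"
    using assms by (auto simp: invertible_spd spd_def)
  show "sym_mat (matrix_inv A)"
    using inv sym by (rule sym_mat_matrix_inv)
  fix x :: "real^'d" assume "x \<noteq> 0"
  then have "matrix_inv A *v x \<noteq> 0"
    using matrix_inv_cancel(1)[OF inv, of x] by auto
  then have "0 < qf A (matrix_inv A *v x)"
    using assms by (simp add: spd_def)
  then show "0 < qf (matrix_inv A) x"
    by (simp add: qf_def matrix_inv_cancel inv inner_commute)
qed

section \<open>Spectral theorem and the Rayleigh bound\<close>

lemma symmetric_eigenvector_in_subspace:
  fixes A :: "'d::finite mat"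
  assumes A: "sym_mat A" and V: "subspace V" "V \<noteq> {0}" "\<And>x. x \<in> V \<Longrightarrow> A *v x \<in> V"
  obtains v l where "v \<in> V" "norm v = 1" "A *v v = l *\<^sub>R v"
proof -
  obtain a where a: "a \<in> V" "a \<noteq> 0"
    using V subspace_0 by blast
  then have "a /\<^sub>R norm a \<in> V \<inter> sphere 0 1"
    using V(1) by (simp add: subspace_scale)
  then have "V \<inter> sphere 0 1 \<noteq> {}"
    by blast
  moreover have "compact (V \<inter> sphere 0 1)"
    using V(1) by (intro closed_Int_compact closed_subspace) auto
  moreover have "continuous_on (V \<inter> sphere 0 1) (qf A)"
    unfolding qf_def by (intro continuous_intros matrix_vector_mult_linear_continuous_on)
  ultimately obtain v where "v \<in> V \<inter> sphere 0 1"
    and "\<forall>y\<in>V \<inter> sphere 0 1. qf A y \<le> qf A v"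
    using continuous_attains_sup[of "V \<inter> sphere 0 1" "qf A"] by blast
  then have v: "v \<in> V" "norm v = 1"
    and max: "\<And>y. y \<in> V \<Longrightarrow> norm y = 1 \<Longrightarrow> qf A y \<le> qf A v"
    by auto
  have rayleigh: "qf A y \<le> qf A v * (norm y)\<^sup>2" if "y \<in> V" for y
  proof (cases "y = 0")
    case False
    then have "qf A (y /\<^sub>R norm y) \<le> qf A v"
      using that V(1) by (intro max) (auto simp: subspace_scale)
    then show ?thesis
      using False by (simp add: qf_scaleR field_simps)
  qed simp
  \<comment> \<open>The residual of the eigenvector equation; invariance of \<open>V\<close> makes
    it an admissible direction. Moving \<open>v\<close> by \<open>t\<close> along \<open>w\<close>
    gains 2 t |w|^2 to first order, while maximality allows at most t^2 \<open>C\<close>.\<close>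
  define w where "w = A *v v - qf A v *\<^sub>R v"
  define C where "C = qf A v * (norm w)\<^sup>2 - qf A w"
  have w: "w \<in> V"
    using v V by (simp add: w_def subspace_diff subspace_scale)
  have C: "0 \<le> C"
    using rayleigh[OF w] by (simp add: C_def)
  have key: "2 * t * (norm w)\<^sup>2 \<le> t\<^sup>2 * C" for t
  proof -
    have "qf A (v + t *\<^sub>R w) \<le> qf A v * (norm (v + t *\<^sub>R w))\<^sup>2"
      using v w V(1) by (intro rayleigh) (auto simp: subspace_add subspace_scale)
    moreover have "(norm (v + t *\<^sub>R w))\<^sup>2 = 1 + 2 * t * (v \<bullet> w) + t\<^sup>2 * (norm w)\<^sup>2"
      using v(2) unfolding power2_norm_eq_inner norm_eq_1
      by (simp add: inner_add_left inner_add_right inner_commute power2_eq_square algebra_simps)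
    ultimately have "qf A v + 2 * t * ((A *v v) \<bullet> w) + t\<^sup>2 * qf A w
        \<le> qf A v * (1 + 2 * t * (v \<bullet> w) + t\<^sup>2 * (norm w)\<^sup>2)"
      by (simp add: qf_add[OF A] qf_scaleR)
    moreover have N: "(norm w)\<^sup>2 = (A *v v) \<bullet> w - qf A v * (v \<bullet> w)"
      by (simp add: power2_norm_eq_inner w_def[symmetric] flip: inner_diff_left inner_scaleR_left)
    have "2 * t * (norm w)\<^sup>2 = 2 * t * ((A *v v) \<bullet> w) - qf A v * (2 * t * (v \<bullet> w))"
      unfolding N by (simp add: right_diff_distrib)
    ultimately show ?thesis
      unfolding C_def by (simp only: distrib_left right_diff_distrib) (simp add: algebra_simps)
  qed
  have "w = 0"
  proof (rule ccontr)
    assume "w \<noteq> 0"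
    then have "0 < (norm w)\<^sup>2" by simp
    \<comment> \<open>Small enough that t C < 2 |w|^2, which contradicts \<open>key\<close>; the
      added 1 keeps the denominator positive when \<open>C\<close> is 0.\<close>
    moreover define t where "t = (norm w)\<^sup>2 / (C + 1)"
    ultimately have t: "0 < t" "t * (C + 1) = (norm w)\<^sup>2"
      using C by simp_all
    then have "t * C < 2 * (norm w)\<^sup>2"
      using \<open>0 < (norm w)\<^sup>2\<close> unfolding distrib_left by linarith
    then have "t * (t * C) < t * (2 * (norm w)\<^sup>2)"
      using t(1) by (rule mult_strict_left_mono)
    with key[of t] show False
      by (simp add: power2_eq_square algebra_simps)
  qed
  then show ?thesis
    using v that[of v "qf A v"] by (simp add: w_def)
qed

text \<open>Formulated for invariant subspaces because the induction passes to the orthogonal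
  complement of an eigenvector \<open>v\<close>, which is not itself of type \<open>real^'d\<close>.
  Symmetry keeps that complement invariant: if x is orthogonal to v, then the inner product of v
  with A x is that of A v with x, hence 0.\<close>

lemma spectral_subspace:
  fixes A :: "'d::finite mat"
  assumes A: "sym_mat A" and V: "subspace V" "\<And>x. x \<in> V \<Longrightarrow> A *v x \<in> V"
  shows "\<exists>B l. finite B \<and> B \<subseteq> V \<and> pairwise orthogonal B \<and> (\<forall>b\<in>B. norm b = 1 \<and> A *v b = l b *\<^sub>R b)
    \<and> (\<forall>x\<in>V. x = (\<Sum>b\<in>B. (b \<bullet> x) *\<^sub>R b))"
  using V
proof (induction "dim V" arbitrary: V rule: less_induct)
  case less
  show ?case
  proof (cases "V = {0}")
    case True
    then show ?thesis by (intro exI[of _ "{}"]) auto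
  next
    case False
    then obtain v m where v: "v \<in> V" "norm v = 1" "A *v v = m *\<^sub>R v"
      using symmetric_eigenvector_in_subspace[OF A less.prems(1) _ less.prems(2)] by blast
    have vv: "v \<bullet> v = 1" using v by (simp add: norm_eq_1)
    define W where "W = V \<inter> {x. v \<bullet> x = 0}"
    have W: "subspace W"
      unfolding W_def using less.prems(1) by (intro subspace_inter subspace_hyperplane)
    have "v \<notin> W"
      using vv by (simp add: W_def)
    then have "W \<subset> V"
      using v(1) W_def by blast
    then have "dim W < dim V"
      using W less.prems(1) by (intro dim_psubset) (simp add: span_eq_iff[THEN iffD2])
    moreover have "A *v x \<in> W" if "x \<in> W" for x
      using that less.prems(2) v(3) by (auto simp: W_def sym_mat_inner[OF A])
    ultimately obtain B l where B: "finite B" "B \<subseteq> W" "pairwise orthogonal B"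
      "\<And>b. b \<in> B \<Longrightarrow> norm b = 1 \<and> A *v b = l b *\<^sub>R b"
      "\<And>x. x \<in> W \<Longrightarrow> x = (\<Sum>b\<in>B. (b \<bullet> x) *\<^sub>R b)"
      using less.hyps[of W] W by blast
    have vB: "v \<bullet> b = 0" if "b \<in> B" for b
      using B(2) that by (auto simp: W_def)
    then have "v \<notin> B" using vv by force
    have "x = (\<Sum>b\<in>insert v B. (b \<bullet> x) *\<^sub>R b)" if "x \<in> V" for x
    proof -
      have "x - (v \<bullet> x) *\<^sub>R v \<in> W"
        using that v(1) vv less.prems(1)
        by (simp add: W_def subspace_diff subspace_scale inner_diff_right)
      then have "x - (v \<bullet> x) *\<^sub>R v = (\<Sum>b\<in>B. (b \<bullet> (x - (v \<bullet> x) *\<^sub>R v)) *\<^sub>R b)"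
        by (rule B)
      also have "\<dots> = (\<Sum>b\<in>B. (b \<bullet> x) *\<^sub>R b)"
        using vB by (intro sum.cong) (auto simp: inner_diff_right inner_commute)
      finally show ?thesis
        using \<open>v \<notin> B\<close> B(1) by (simp add: algebra_simps)
    qed
    moreover have "pairwise orthogonal (insert v B)"
      using B(3) vB by (auto simp: pairwise_insert orthogonal_def inner_commute)
    ultimately show ?thesis
      using B v \<open>v \<notin> B\<close>
      by (intro exI[of _ "insert v B"] exI[of _ "l(v := m)"]) (auto simp: W_def)
  qed
qed

lemma spectral_theorem:
  fixes A :: "'d::finite mat"
  assumes "sym_mat A"
  obtains B l where "finite B" "\<And>b. b \<in> B \<Longrightarrow> norm b = 1" "\<And>b. b \<in> B \<Longrightarrow> A *v b = l b *\<^sub>R b"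
    "pairwise orthogonal B" "\<And>x. x = (\<Sum>b\<in>B. (b \<bullet> x) *\<^sub>R b)"
  using spectral_subspace[OF assms subspace_UNIV] by auto

lemma qf_le_lambda_max:
  fixes A :: "'d::finite mat"
  assumes A: "sym_mat A"
  shows "qf A x \<le> lambda_max A * (norm x)\<^sup>2"
proof -
  obtain B l where B: "finite B" "\<And>b. b \<in> B \<Longrightarrow> norm b = 1" "\<And>b. b \<in> B \<Longrightarrow> A *v b = l b *\<^sub>R b"
    "\<And>x. x = (\<Sum>b\<in>B. (b \<bullet> x) *\<^sub>R b)"
    by (rule spectral_theorem[OF A]) (rule that)
  let ?E = "{l. \<exists>v. v \<noteq> 0 \<and> A *v v = l *\<^sub>R v}"
  \<comment> \<open>\<open>Max\<close> is informative only on a finite set. An eigenvector has a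
    nonzero component along some \<open>b\<close>, and comparing that component on both sides of the
    eigenvalue equation forces the eigenvalue to be \<open>l b\<close>.\<close>
  have "?E \<subseteq> l ` B"
  proof safe
    fix m v assume v: "v \<noteq> 0" "A *v v = m *\<^sub>R v"
    have "\<exists>b\<in>B. b \<bullet> v \<noteq> 0"
    proof (rule ccontr)
      assume "\<not> ?thesis"
      then have "(\<Sum>b\<in>B. (b \<bullet> v) *\<^sub>R b) = 0" by (intro sum.neutral) auto
      with B(4)[of v] v(1) show False by simp
    qed
    then obtain b where b: "b \<in> B" "b \<bullet> v \<noteq> 0" by blast
    have "m * (b \<bullet> v) = l b * (b \<bullet> v)"
      using sym_mat_inner[OF A, of b v] v(2) B(3)[OF b(1)] by simp
    then show "m \<in> l ` B" using b by auto
  qed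
  then have fin: "finite ?E"
    using B(1) finite_surj by blast
  have le: "l b \<le> lambda_max A" if "b \<in> B" for b
    unfolding lambda_max_def
  proof (rule Max_ge[OF fin])
    have "b \<noteq> 0" using B(2)[OF that] by force
    then show "l b \<in> ?E" using B(3)[OF that] by auto
  qed
  have expand: "y \<bullet> x = (\<Sum>b\<in>B. (b \<bullet> y) * (b \<bullet> x))" for y
    by (subst B(4)[of x]) (simp add: inner_sum_right inner_commute mult.commute)
  have "qf A x = (\<Sum>b\<in>B. l b * (b \<bullet> x)\<^sup>2)"
    unfolding qf_def sym_mat_inner[OF A] expand[of "A *v x"]
    by (intro sum.cong) (auto simp: sym_mat_inner[OF A] B(3) power2_eq_square)
  also have "\<dots> \<le> (\<Sum>b\<in>B. lambda_max A * (b \<bullet> x)\<^sup>2)"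
    using le by (intro sum_mono mult_right_mono) auto
  also have "\<dots> = lambda_max A * (norm x)\<^sup>2"
    unfolding power2_norm_eq_inner expand[of x] by (simp add: power2_eq_square sum_distrib_left)
  finally show ?thesis .
qed

lemma lambda_max_nonneg:
  fixes A :: "'d::finite mat"
  assumes "psd A"
  shows "0 \<le> lambda_max A"
proof -
  fix i :: 'd
  have "0 \<le> qf A (axis i 1)" using assms by (simp add: psd_def)
  also have "\<dots> \<le> lambda_max A * (norm (axis i (1::real)))\<^sup>2"
    using assms by (intro qf_le_lambda_max) (simp add: psd_def)
  finally show ?thesis by simp
qed

section \<open>Positive square roots\<close>

lemma psd_square_root_exists:
  fixes A :: "'d::finite mat"
  assumes A: "psd A"
  shows "\<exists>S. psd S \<and> S ** S = A"
proof -
  have sym: "sym_mat A" using A by (simp add: psd_def)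
  obtain B l where B: "finite B" "\<And>b. b \<in> B \<Longrightarrow> norm b = 1" "\<And>b. b \<in> B \<Longrightarrow> A *v b = l b *\<^sub>R b"
    "pairwise orthogonal B" "\<And>x. x = (\<Sum>b\<in>B. (b \<bullet> x) *\<^sub>R b)"
    by (rule spectral_theorem[OF sym]) (rule that)
  \<comment> \<open>\<open>h\<close> keeps the eigenbasis and replaces each eigenvalue by its square
    root.\<close>
  define h where "h x = (\<Sum>b\<in>B. (sqrt (l b) * (b \<bullet> x)) *\<^sub>R b)" for x
  have lin: "linear h"
    by (rule linearI) (simp_all add: h_def inner_add_right algebra_simps scaleR_add_left
        sum.distrib scaleR_sum_right)
  have S: "matrix h *v x = h x" for x
    using fun_cong[OF matrix_vector_mul(2)[of h]] lin by (simp add: linear_conv_bounded_linear)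
  have ip: "b \<bullet> c = (if b = c then 1 else 0)" if "b \<in> B" "c \<in> B" for b c
    using B(2,4) that by (auto simp: pairwise_def orthogonal_def norm_eq_1)
  have l: "0 \<le> l b" if "b \<in> B" for b
  proof -
    have "qf A b = l b" by (simp add: qf_def B(3)[OF that] ip[OF that that])
    then show ?thesis using A by (metis psd_def)
  qed
  have hb: "b \<bullet> h x = sqrt (l b) * (b \<bullet> x)" if "b \<in> B" for b x
  proof -
    have "b \<bullet> h x = (\<Sum>c\<in>B. if b = c then sqrt (l b) * (b \<bullet> x) else 0)"
      unfolding h_def inner_sum_right using that by (intro sum.cong) (auto simp: ip)
    then show ?thesis using that B(1) by simp
  qed
  have inner_h: "x \<bullet> h y = (\<Sum>b\<in>B. sqrt (l b) * (b \<bullet> x) * (b \<bullet> y))" for x y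
    unfolding h_def inner_sum_right by (intro sum.cong) (auto simp: inner_commute)
  have "psd (matrix h)"
    unfolding psd_def
  proof
    show "sym_mat (matrix h)"
    proof (rule sym_matI)
      show "x \<bullet> (matrix h *v y) = (matrix h *v x) \<bullet> y" for x y
        by (simp add: S inner_commute[of "h x"] inner_h mult.commute mult.left_commute)
    qed
    show "\<forall>x. 0 \<le> qf (matrix h) x"
      using l by (auto simp: qf_def S inner_h mult.assoc intro!: sum_nonneg)
  qed
  moreover have "matrix h *v (matrix h *v x) = A *v x" for x
  proof -
    have "A *v x = (\<Sum>b\<in>B. (b \<bullet> (A *v x)) *\<^sub>R b)" by (rule B)
    also have "\<dots> = (\<Sum>b\<in>B. (sqrt (l b) * (b \<bullet> h x)) *\<^sub>R b)"
      using l by (intro sum.cong) (auto simp: sym_mat_inner[OF sym] B(3) hb)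
    finally show ?thesis by (simp add: S h_def[of "h x"])
  qed
  ultimately show ?thesis
    by (intro exI[of _ "matrix h"]) (simp add: matrix_eq matrix_vector_mul_assoc)
qed

text \<open>If the form of \<open>S\<close> vanished at x with S x nonzero, a small move from x
  against S x would make it negative; and S x = 0 contradicts the definiteness of S S.\<close>

lemma spd_square_root:
  fixes A S :: "'d::finite mat"
  assumes A: "spd A" and S: "psd S" "S ** S = A"
  shows "spd S"
  unfolding spd_def
proof (intro conjI allI impI)
  show symS: "sym_mat S" using S by (simp add: psd_def)
  fix x :: "real^'d" assume "x \<noteq> 0"
  have ge: "0 \<le> qf S y" for y using S by (simp add: psd_def)
  have "qf S x \<noteq> 0"
  proof
    assume 0: "qf S x = 0"
    have nz: "S *v x \<noteq> 0"
    proof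
      assume "S *v x = 0"
      then have "qf A x = 0" by (simp add: S(2)[symmetric] qf_square[OF symS])
      then show False using A \<open>x \<noteq> 0\<close> by (force simp: spd_def)
    qed
    define y where "y = S *v x"
    define t where "t = (norm y)\<^sup>2 / (qf S y + 1)"
    have "0 < (norm y)\<^sup>2" using nz by (simp add: y_def)
    then have t: "0 < t" "t * qf S y < 2 * (norm y)\<^sup>2"
      using ge[of y] by (simp_all add: t_def divide_simps algebra_simps add_pos_nonneg add_nonneg_pos)
    have "0 \<le> qf S (x + - (t *\<^sub>R y))" by (rule ge)
    also have "\<dots> = t * (t * qf S y - 2 * (norm y)\<^sup>2)"
      unfolding qf_add[OF symS]
      unfolding power2_norm_eq_inner
      by (simp add: qf_scaleR 0 power2_eq_square algebra_simps flip: y_def)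
    also have "\<dots> < 0" using t by (simp add: mult_pos_neg)
    finally show False by simp
  qed
  then show "0 < qf S x" using ge[of x] by simp
qed

text \<open>S and R are not known to commute, so S^2 - R^2 has no direct factorization. Pairing the
  two-term identity below with an eigenvector \<open>b\<close> of \<open>S - R\<close> gives
  \<open>l b * (qf S b + qf R b) = 0\<close>, and definiteness forces
  \<open>l b = 0\<close>.\<close>

lemma spd_square_root_unique:
  fixes S R :: "'d::finite mat"
  assumes S: "spd S" and R: "spd R" and eq: "S ** S = R ** R"
  shows "S = R"
proof -
  have sym: "sym_mat (S - R)"
    using S R by (auto simp: spd_def intro: sym_mat_diff)
  obtain B l where B: "\<And>b. b \<in> B \<Longrightarrow> norm b = 1" "\<And>b. b \<in> B \<Longrightarrow> (S - R) *v b = l b *\<^sub>R b"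
    "\<And>x. x = (\<Sum>b\<in>B. (b \<bullet> x) *\<^sub>R b)"
    by (rule spectral_theorem[OF sym]) (rule that)
  have "l b = 0" if "b \<in> B" for b
  proof -
    have "b \<noteq> 0" using B(1)[OF that] by force
    \<comment> \<open>\<open>(S - R) S + R (S - R) = S\<^sup>2 - R\<^sup>2 = 0\<close>\<close>
    have "(S - R) *v (S *v b) + R *v ((S - R) *v b) = (S ** S) *v b - (R ** R) *v b"
      by (simp add: matrix_vector_mult_diff_rdistrib matrix_vector_mult_diff_distrib
          flip: matrix_vector_mul_assoc)
    then have "b \<bullet> ((S - R) *v (S *v b)) + b \<bullet> (R *v ((S - R) *v b)) = 0"
      by (simp add: eq flip: inner_add_right)
    then have "l b * (qf S b + qf R b) = 0"
      by (simp add: sym_mat_inner[OF sym] B(2)[OF that] matrix_vector_mult_scaleR qf_def distrib_left)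
    moreover have "0 < qf S b + qf R b"
      using S R \<open>b \<noteq> 0\<close> by (simp add: spd_def add_pos_pos)
    ultimately show ?thesis by simp
  qed
  then have "(S - R) *v x = 0" for x
    by (subst B(3)[of "(S - R) *v x"]) (simp add: sym_mat_inner[OF sym] B(2))
  then show ?thesis
    by (simp add: matrix_eq matrix_vector_mult_diff_rdistrib)
qed

text \<open>The description ranges over psd roots, so each candidate is first upgraded to a positive
  definite one before uniqueness applies.\<close>

lemma msqrt_spd:
  assumes "spd A"
  shows "spd (msqrt A)" "msqrt A ** msqrt A = A"
proof -
  have "\<exists>!S. psd S \<and> S ** S = A"
  proof (rule ex_ex1I)
    show "\<exists>S. psd S \<and> S ** S = A"
      by (intro psd_square_root_exists spd_imp_psd assms)
    fix S R assume S: "psd S \<and> S ** S = A" and R: "psd R \<and> R ** R = A"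
    show "S = R"
    proof (rule spd_square_root_unique)
      show "spd S" "spd R"
        using S R by (auto intro: spd_square_root[OF assms])
      show "S ** S = R ** R"
        using S R by simp
    qed
  qed
  then have "psd (msqrt A) \<and> msqrt A ** msqrt A = A"
    unfolding msqrt_def by (rule theI')
  then show "spd (msqrt A)" "msqrt A ** msqrt A = A"
    using spd_square_root[OF assms] by auto
qed

lemma
  assumes "spd A"
  shows qf_eq_norm_msqrt: "qf A x = (norm (msqrt A *v x))\<^sup>2"
    and qf_inv_eq_norm_msqrt: "qf (matrix_inv A) x = (norm (matrix_inv (msqrt A) *v x))\<^sup>2"
proof -
  note R = msqrt_spd[OF assms]
  have sym: "sym_mat (msqrt A)" and inv: "invertible (msqrt A)"
    using R(1) by (auto simp: spd_def invertible_spd)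
  show *: "qf A x = (norm (msqrt A *v x))\<^sup>2" for x
    using qf_square[OF sym, of x] by (simp add: R(2))
  \<comment> \<open>Yields A^{1/2} A^{-1} = A^{-1/2}, which turns the A-norm of A^{-1} x into a
    Euclidean norm.\<close>
  have "msqrt A *v (msqrt A *v (matrix_inv A *v x)) = x"
    using matrix_inv_cancel(1)[OF invertible_spd[OF assms]]
    by (simp only: matrix_vector_mul_assoc matrix_mul_assoc R(2))
  then have "msqrt A *v (matrix_inv A *v x) = matrix_inv (msqrt A) *v x"
    by (metis matrix_inv_cancel(2) inv)
  moreover have "qf (matrix_inv A) x = qf A (matrix_inv A *v x)"
    by (simp add: qf_def matrix_inv_cancel invertible_spd assms inner_commute)
  ultimately show "qf (matrix_inv A) x = (norm (matrix_inv (msqrt A) *v x))\<^sup>2"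
    by (simp add: *)
qed

section \<open>Dual norms and eigenvalue comparisons\<close>

lemma inner_le_mnorm:
  assumes "spd A"
  shows "x \<bullet> y \<le> mnorm (matrix_inv A) x * mnorm A y"
proof -
  \<comment> \<open>Inserting A^{-1/2} A^{1/2} reduces the claim to the ordinary Cauchy-Schwarz
    inequality.\<close>
  have "x \<bullet> y = (matrix_inv (msqrt A) *v x) \<bullet> (msqrt A *v y)"
    using msqrt_spd[OF assms]
    by (simp add: matrix_inv_cancel invertible_spd spd_def flip: sym_mat_inner[OF sym_mat_matrix_inv])
  also have "\<dots> \<le> mnorm (matrix_inv A) x * mnorm A y"
    unfolding mnorm_def qf_eq_norm_msqrt[OF assms] qf_inv_eq_norm_msqrt[OF assms]
    by (simp add: norm_cauchy_schwarz)
  finally show ?thesis .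
qed

text \<open>The Rayleigh bound at A^{-1/2} x, whose A-norm is |x| and whose Euclidean norm is the
  A^{-1}-norm of x.\<close>

lemma norm_le_lambda_max_qf_inv:
  assumes "spd A"
  shows "(norm x)\<^sup>2 \<le> lambda_max A * qf (matrix_inv A) x"
proof -
  have R: "spd (msqrt A)" "invertible (msqrt A)"
    using msqrt_spd[OF assms] by (auto simp: invertible_spd)
  have "(norm x)\<^sup>2 = qf A (matrix_inv (msqrt A) *v x)"
    by (simp add: qf_eq_norm_msqrt assms matrix_inv_cancel R)
  also have "\<dots> \<le> lambda_max A * (norm (matrix_inv (msqrt A) *v x))\<^sup>2"
    using assms by (intro qf_le_lambda_max) (simp add: spd_def)
  finally show ?thesis by (simp add: qf_inv_eq_norm_msqrt assms)
qed

text \<open>Substituting y = L^{1/2} x turns a comparison of two forms into a Rayleigh bound against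
  the Euclidean norm of y.\<close>

lemma qf_le_relative_lambda_max:
  assumes L: "spd L" and A: "sym_mat A"
  shows "qf A x \<le> lambda_max (matrix_inv (msqrt L) ** A ** matrix_inv (msqrt L)) * qf L x"
proof -
  let ?Q = "matrix_inv (msqrt L)"
  have R: "spd (msqrt L)" "invertible (msqrt L)"
    using msqrt_spd[OF L] by (auto simp: invertible_spd)
  then have Q: "sym_mat ?Q" using spd_matrix_inv spd_def by blast
  have "qf A x = qf (?Q ** A ** ?Q) (msqrt L *v x)"
    by (simp add: qf_mult_sym[OF Q] matrix_inv_cancel R)
  also have "\<dots> \<le> lambda_max (?Q ** A ** ?Q) * (norm (msqrt L *v x))\<^sup>2"
    by (intro qf_le_lambda_max sym_mat_mult A Q)
  finally show ?thesis by (simp add: qf_eq_norm_msqrt[OF L])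
qed

section \<open>Smoothness and random sketches\<close>

lemma lip_grad_descent:
  fixes F :: "real^'d::finite \<Rightarrow> real^'d"
  assumes L: "spd L" and lip: "lip_grad F L"
    and deriv: "\<And>x. (f has_derivative (\<lambda>h. F x \<bullet> h)) (at x)"
  shows "f (x - g) \<le> f x - F x \<bullet> g + qf L g / 2"
proof -
  have nonneg: "0 \<le> qf L y" for y
    using spd_imp_psd[OF L] by (simp add: psd_def)
  \<comment> \<open>The claim is \<open>\<psi> 1 \<le> \<psi> 0\<close>. The derivative pairs F x -
    F (x - t g) with g and subtracts t |g|_L^2; duality and the Lipschitz bound make it nonpositive.
    Monotonicity replaces integration of the gradient along the segment.\<close>
  define \<psi> where "\<psi> t = f (x - t *\<^sub>R g) + t * (F x \<bullet> g) - t\<^sup>2 / 2 * qf L g" for t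
  have "\<psi> 1 \<le> \<psi> 0"
  proof (rule DERIV_nonpos_imp_nonincreasing[where f = \<psi>])
    fix t :: real assume t: "0 \<le> t" "t \<le> 1"
    have "((\<lambda>t. f (x - t *\<^sub>R g)) has_derivative (\<lambda>h. F (x - t *\<^sub>R g) \<bullet> (- (h *\<^sub>R g)))) (at t)"
      by (rule has_derivative_compose[OF _ deriv]) (auto intro!: derivative_eq_intros)
    then have D0: "((\<lambda>t. f (x - t *\<^sub>R g)) has_field_derivative - (F (x - t *\<^sub>R g) \<bullet> g)) (at t)"
      unfolding has_field_derivative_def by (rule has_derivative_eq_rhs) (auto simp: mult.commute fun_eq_iff)
    have D: "(\<psi> has_field_derivative - (F (x - t *\<^sub>R g) \<bullet> g) + F x \<bullet> g - t * qf L g) (at t)"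
      unfolding \<psi>_def by (rule D0 derivative_eq_intros refl | simp)+
    have "(F x - F (x - t *\<^sub>R g)) \<bullet> g \<le> mnorm (matrix_inv L) (F x - F (x - t *\<^sub>R g)) * mnorm L g"
      by (rule inner_le_mnorm[OF L])
    also have "\<dots> \<le> mnorm L (t *\<^sub>R g) * mnorm L g"
      using lip[unfolded lip_grad_def, rule_format, of x "x - t *\<^sub>R g"] nonneg
      by (intro mult_right_mono) (auto simp: mnorm_def)
    also have "\<dots> = t * qf L g"
      using t nonneg by (simp add: mnorm_def qf_scaleR real_sqrt_mult)
    finally show "\<exists>y. DERIV \<psi> t :> y \<and> y \<le> 0"
      using D by (auto simp: inner_diff_left)
  qed simp
  then show ?thesis
    by (simp add: \<psi>_def)
qed

section \<open>Continuity, measurability and integrability of matrix expressions\<close>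

lemma bounded_bilinear_matrix_mult: "bounded_bilinear ((**) :: 'd::finite mat \<Rightarrow> 'd mat \<Rightarrow> 'd mat)"
  unfolding bilinear_conv_bounded_bilinear[symmetric] bilinear_def
  by (auto intro!: linearI simp: matrix_matrix_mult_def vec_eq_iff sum.distrib distrib_left
      distrib_right sum_distrib_left mult_ac)

lemma bounded_bilinear_matrix_vector_mult:
  "bounded_bilinear ((*v) :: 'd::finite mat \<Rightarrow> real^'d \<Rightarrow> real^'d)"
  unfolding bilinear_conv_bounded_bilinear[symmetric] bilinear_def
  by (auto intro!: linearI simp: matrix_vector_right_distrib matrix_vector_mult_add_rdistrib
      scaleR_matrix_vector matrix_vector_mult_scaleR)

lemma bounded_linear_qf_matrix: "bounded_linear (\<lambda>M. qf M z)"
  unfolding qf_def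
  by (intro bounded_linear_inner_right_comp
      bounded_bilinear.bounded_linear_left[OF bounded_bilinear_matrix_vector_mult])

lemma bounded_linear_transpose: "bounded_linear (transpose :: 'd::finite mat \<Rightarrow> 'd mat)"
  unfolding linear_conv_bounded_linear[symmetric]
  by (rule linearI) (simp_all add: transpose_def vec_eq_iff)

lemma borel_measurable_qf [measurable]: "qf A \<in> borel_measurable borel"
  unfolding qf_def
  by (intro borel_measurable_continuous_onI continuous_intros matrix_vector_mult_linear_continuous_on)

lemma borel_measurable_matrix_vector_mult [measurable]:
  fixes f :: "'a \<Rightarrow> 'd::finite mat"
  assumes "f \<in> borel_measurable M" "g \<in> borel_measurable M"
  shows "(\<lambda>x. f x *v g x) \<in> borel_measurable M"
  by (rule borel_measurable_continuous_Pair[OF assms])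
    (intro bounded_bilinear.continuous_on[OF bounded_bilinear_matrix_vector_mult] continuous_intros)

lemma borel_measurable_matrix_mult [measurable]:
  fixes f g :: "'a \<Rightarrow> 'd::finite mat"
  assumes "f \<in> borel_measurable M" "g \<in> borel_measurable M"
  shows "(\<lambda>x. f x ** g x) \<in> borel_measurable M"
  by (rule borel_measurable_continuous_Pair[OF assms])
    (intro bounded_bilinear.continuous_on[OF bounded_bilinear_matrix_mult] continuous_intros)

lemma integrable_qf:
  assumes W: "W \<in> borel_measurable M" and sq: "integrable M (\<lambda>x. (norm (W x))\<^sup>2)"
  shows "integrable M (\<lambda>x. qf A (W x))"
proof (rule Bochner_Integration.integrable_bound)
  show "integrable M (\<lambda>x. onorm ((*v) A) * (norm (W x))\<^sup>2)"
    using sq by simp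
  show "(\<lambda>x. qf A (W x)) \<in> borel_measurable M"
    using W by measurable
  have "\<bar>qf A w\<bar> \<le> onorm ((*v) A) * (norm w)\<^sup>2" for w
  proof -
    have "\<bar>qf A w\<bar> \<le> norm w * norm (A *v w)"
      unfolding qf_def by (rule Cauchy_Schwarz_ineq2)
    also have "\<dots> \<le> norm w * (onorm ((*v) A) * norm w)"
      by (intro mult_left_mono onorm) auto
    finally show ?thesis by (simp add: power2_eq_square mult_ac)
  qed
  then show "AE x in M. norm (qf A (W x)) \<le> norm (onorm ((*v) A) * (norm (W x))\<^sup>2)"
    by (intro AE_I2) (force intro: order_trans)
qed

section \<open>Second moments of independent centered sums\<close>

lemma nn_integral_qf_centered:
  fixes W :: "'a \<Rightarrow> real^'d::finite"
  assumes "prob_space M" and A: "psd A" and W: "integrable M W" "(\<integral>x. W x \<partial>M) = 0"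
    and sq: "integrable M (\<lambda>x. (norm (W x))\<^sup>2)"
  shows "(\<integral>\<^sup>+x. ennreal (qf A (u + W x)) \<partial>M) = ennreal (qf A u + (\<integral>x. qf A (W x) \<partial>M))"
proof -
  interpret prob_space M by fact
  have sym: "sym_mat A" and nonneg: "0 \<le> qf A y" for y
    using A by (auto simp: psd_def)
  have int: "integrable M (\<lambda>x. qf A (W x))"
    using W(1) sq by (intro integrable_qf) auto
  have "(\<integral>\<^sup>+x. ennreal (qf A (u + W x)) \<partial>M) = ennreal (\<integral>x. qf A (u + W x) \<partial>M)"
  proof (rule nn_integral_eq_integral)
    show "integrable M (\<lambda>x. qf A (u + W x))"
      using int W(1) by (simp add: qf_add[OF sym])
  qed (simp add: nonneg)
  also have "(\<integral>x. qf A (u + W x) \<partial>M) = qf A u + (\<integral>x. qf A (W x) \<partial>M)"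
    using int W by (simp add: qf_add[OF sym] prob_space)
  finally show ?thesis .
qed

text \<open>With all sketches but one fixed, their contribution is just part of a deterministic
  shift, so \<open>nn_integral_qf_centered\<close> removes the cross terms of the remaining one all
  at once.\<close>

lemma nn_integral_qf_sum_indep:
  fixes W :: "'i \<Rightarrow> 'a \<Rightarrow> real^'d::finite"
  assumes S: "prob_space S" and A: "psd A" and "finite I"
    and W: "\<And>i. i \<in> I \<Longrightarrow> integrable S (W i)" "\<And>i. i \<in> I \<Longrightarrow> (\<integral>x. W i x \<partial>S) = 0"
      "\<And>i. i \<in> I \<Longrightarrow> integrable S (\<lambda>x. (norm (W i x))\<^sup>2)"
  shows "(\<integral>\<^sup>+T. ennreal (qf A (u + (\<Sum>i\<in>I. W i (T i)))) \<partial>(\<Pi>\<^sub>M i\<in>I. S))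
       = ennreal (qf A u + (\<Sum>i\<in>I. \<integral>x. qf A (W i x) \<partial>S))"
  using \<open>finite I\<close> W
proof (induction I)
  case empty
  then show ?case by (simp add: PiM_empty nn_integral_count_space_finite)
next
  case (insert j I)
  interpret product_prob_space "\<lambda>_. S" I
    by (rule product_prob_spaceI) (rule S)
  have nonneg: "0 \<le> qf A y" for y
    using A by (auto simp: psd_def)
  define v where "v = (\<integral>x. qf A (W j x) \<partial>S)"
  have [simp]: "0 \<le> v" "0 \<le> (\<Sum>i\<in>I. \<integral>x. qf A (W i x) \<partial>S)"
    by (auto simp: v_def nonneg intro!: sum_nonneg)
  have [measurable]: "\<And>i. i \<in> insert j I \<Longrightarrow> W i \<in> borel_measurable S"
    by (rule borel_measurable_integrable[OF insert.prems(1)])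
  let ?s = "\<lambda>T. \<Sum>i\<in>I. W i (T i)"
  have "(\<integral>\<^sup>+T. ennreal (qf A (u + (\<Sum>i\<in>insert j I. W i (T i)))) \<partial>(\<Pi>\<^sub>M i\<in>insert j I. S))
      = (\<integral>\<^sup>+T. \<integral>\<^sup>+x. ennreal (qf A (u + (\<Sum>i\<in>insert j I. W i ((T(j := x)) i)))) \<partial>S \<partial>(\<Pi>\<^sub>M i\<in>I. S))"
    using insert.hyps by (intro product_nn_integral_insert) measurable
  also have "\<dots> = (\<integral>\<^sup>+T. \<integral>\<^sup>+x. ennreal (qf A ((u + ?s T) + W j x)) \<partial>S \<partial>(\<Pi>\<^sub>M i\<in>I. S))"
  proof (intro nn_integral_cong)
    fix T :: "'i \<Rightarrow> 'a" and x
    have "(\<Sum>i\<in>I. W i (if i = j then x else T i)) = ?s T"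
      using insert.hyps by (intro sum.cong) auto
    then show "ennreal (qf A (u + (\<Sum>i\<in>insert j I. W i ((T(j := x)) i)))) = ennreal (qf A ((u + ?s T) + W j x))"
      using insert.hyps by (simp add: add_ac)
  qed
  also have "\<dots> = (\<integral>\<^sup>+T. ennreal (qf A (u + ?s T)) + ennreal v \<partial>(\<Pi>\<^sub>M i\<in>I. S))"
    using insert.prems by (simp add: nn_integral_qf_centered[OF S A] v_def nonneg)
  also have "\<dots> = (\<integral>\<^sup>+T. ennreal (qf A (u + ?s T)) \<partial>(\<Pi>\<^sub>M i\<in>I. S)) + ennreal v"
    by (subst nn_integral_add) (auto simp: P.emeasure_space_1)
  also have "\<dots> = ennreal (qf A u + (\<Sum>i\<in>I. \<integral>x. qf A (W i x) \<partial>S)) + ennreal v"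
    using insert by simp
  also have "\<dots> = ennreal (qf A u + (\<Sum>i\<in>insert j I. \<integral>x. qf A (W i x) \<partial>S))"
    using insert.hyps nonneg by (simp add: v_def[symmetric] add_ac flip: ennreal_plus)
  finally show ?case .
qed

section \<open>Moments of a single sketch\<close>

locale sketch = prob_space S for S :: "'d::finite mat measure" +
  assumes sets_S [measurable_cong]: "sets S = sets borel"
    and AE_psd: "AE T in S. psd T"
    and integrable_id: "integrable S (\<lambda>T. T)"
    and mean: "(\<integral>T. T \<partial>S) = mat 1"
    and integrable_sq: "integrable S (\<lambda>T. (norm T)\<^sup>2)"
begin

lemma centered:
  shows integrable_centered: "integrable S (\<lambda>T. T *v z - z)"
    and integral_centered: "(\<integral>T. T *v z - z \<partial>S) = 0"
    and integrable_sq_centered: "integrable S (\<lambda>T. (norm (T *v z - z))\<^sup>2)"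
proof -
  have bl: "bounded_linear (\<lambda>T :: 'd mat. T *v z)"
    by (rule bounded_bilinear.bounded_linear_left[OF bounded_bilinear_matrix_vector_mult])
  show "integrable S (\<lambda>T. T *v z - z)"
    using integrable_bounded_linear[OF bl integrable_id] by simp
  show "(\<integral>T. T *v z - z \<partial>S) = 0"
    using integrable_bounded_linear[OF bl integrable_id] integral_bounded_linear[OF bl integrable_id]
    by (simp add: prob_space mean)
  obtain C where C: "0 \<le> C" "\<And>T. norm (T *v z) \<le> norm (T :: 'd mat) * C"
    using bounded_linear.nonneg_bounded[OF bl] by auto
  have bound: "(norm (T *v z - z))\<^sup>2 \<le> 2 * C\<^sup>2 * (norm T)\<^sup>2 + 2 * (norm z)\<^sup>2" for T
  proof -
    have "(norm (T *v z - z))\<^sup>2 \<le> (norm T * C + norm z)\<^sup>2"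
      using C(2)[of T] by (intro power_mono order_trans[OF norm_triangle_ineq4]) auto
    also have "\<dots> \<le> 2 * (norm T * C)\<^sup>2 + 2 * (norm z)\<^sup>2"
      using sum_squares_bound[of "norm T * C" "norm z"] by (simp add: power2_sum)
    finally show ?thesis by (simp add: power_mult_distrib mult_ac)
  qed
  show "integrable S (\<lambda>T. (norm (T *v z - z))\<^sup>2)"
  proof (rule Bochner_Integration.integrable_bound)
    show "integrable S (\<lambda>T. 2 * C\<^sup>2 * (norm T)\<^sup>2 + 2 * (norm z)\<^sup>2)"
      using integrable_sq by simp
    show "AE T in S. norm ((norm (T *v z - z))\<^sup>2) \<le> norm (2 * C\<^sup>2 * (norm T)\<^sup>2 + 2 * (norm z)\<^sup>2)"
      using bound by (intro AE_I2) (force intro: order_trans)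
  qed measurable
qed

text \<open>Ensures that E[T P T] is a genuine Bochner integral and not the default value 0.\<close>

lemma integrable_congruence: "integrable S (\<lambda>T. T ** (P :: 'd mat) ** T)"
proof -
  interpret bounded_bilinear "(**) :: 'd mat \<Rightarrow> 'd mat \<Rightarrow> 'd mat"
    by (rule bounded_bilinear_matrix_mult)
  obtain C where C: "0 \<le> C" "\<And>(T :: 'd mat) (U :: 'd mat). norm (T ** U) \<le> norm T * norm U * C"
    using nonneg_bounded by metis
  have bound: "norm (T ** P ** T) \<le> norm P * C * C * (norm T)\<^sup>2" for T :: "'d mat"
  proof -
    have "norm (T ** P ** T) \<le> norm (T ** P) * norm T * C"
      by (rule C)
    also have "\<dots> \<le> (norm T * norm P * C) * norm T * C"
      using C by (intro mult_right_mono) auto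
    finally show ?thesis by (simp add: power2_eq_square mult_ac)
  qed
  show ?thesis
  proof (rule Bochner_Integration.integrable_bound)
    show "integrable S (\<lambda>T. norm P * C * C * (norm T)\<^sup>2)"
      using integrable_sq by simp
    show "AE T in S. norm (T ** P ** T) \<le> norm (norm P * C * C * (norm T)\<^sup>2)"
      using order_trans[OF bound abs_ge_self] by (auto simp only: real_norm_def intro!: AE_I2)
  qed measurable
qed

text \<open>Transposition commutes with the Bochner integral and almost every sketch is symmetric.
  Symmetry is what opens the matrix of the step-size condition to
  \<open>qf_le_lambda_max\<close>.\<close>

lemma sym_mat_second_moment:
  fixes P :: "'d mat"
  assumes P: "sym_mat P"
  shows "sym_mat (\<integral>T. T ** P ** T \<partial>S)"
proof -
  have "transpose (\<integral>T. T ** P ** T \<partial>S) = (\<integral>T. transpose (T ** P ** T) \<partial>S)"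
    by (rule integral_bounded_linear[OF bounded_linear_transpose integrable_congruence, symmetric])
  also have "\<dots> = (\<integral>T. T ** P ** T \<partial>S)"
  proof (rule integral_cong_AE)
    show "AE T in S. transpose (T ** P ** T) = T ** P ** T"
      using AE_psd by eventually_elim (use sym_mat_mult[OF P] in \<open>auto simp: psd_def sym_mat_def\<close>)
    show "(\<lambda>T. transpose (T ** P ** T)) \<in> borel_measurable S"
      by (rule borel_measurable_integrable[OF integrable_bounded_linear[OF bounded_linear_transpose integrable_congruence]])
  qed measurable
  finally show ?thesis by (simp add: sym_mat_def)
qed

lemma integral_qf_centered:
  fixes P :: "'d mat"
  assumes P: "sym_mat P"
  shows "(\<integral>T. qf P (T *v z - z) \<partial>S) = qf ((\<integral>T. T ** P ** T \<partial>S) - P) z"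
proof -
  have int: "integrable S (\<lambda>T. qf (T ** P ** T) z)"
    by (rule integrable_bounded_linear[OF bounded_linear_qf_matrix integrable_congruence])
  \<comment> \<open>Obtained by expanding the form at T z = z + (T z - z): the cross term is then
    linear in a centered vector and integrates to 0, while symmetry of T turns the form at T z into
    that of T P T at z.\<close>
  have "(\<integral>T. qf P (T *v z - z) \<partial>S)
      = (\<integral>T. qf (T ** P ** T) z - 2 * ((P *v z) \<bullet> (T *v z - z)) - qf P z \<partial>S)"
  proof (rule integral_cong_AE)
    show "AE T in S. qf P (T *v z - z) = qf (T ** P ** T) z - 2 * ((P *v z) \<bullet> (T *v z - z)) - qf P z"
      using AE_psd
    proof eventually_elim
      fix T :: "'d mat" assume "psd T"
      then have "qf (T ** P ** T) z = qf P (z + (T *v z - z))"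
        by (simp add: psd_def qf_mult_sym)
      then show "qf P (T *v z - z) = qf (T ** P ** T) z - 2 * ((P *v z) \<bullet> (T *v z - z)) - qf P z"
        unfolding qf_add[OF P] by simp
    qed
    show "(\<lambda>T. qf (T ** P ** T) z - 2 * ((P *v z) \<bullet> (T *v z - z)) - qf P z) \<in> borel_measurable S"
      using int by measurable
  qed measurable
  also have "\<dots> = (\<integral>T. qf (T ** P ** T) z \<partial>S) - qf P z"
    using int integrable_centered[of z] integral_centered[of z]
    by (simp add: prob_space)
  also have "(\<integral>T. qf (T ** P ** T) z \<partial>S) = qf (\<integral>T. T ** P ** T \<partial>S) z"
    by (rule integral_bounded_linear[OF bounded_linear_qf_matrix integrable_congruence])
  finally show ?thesis by (simp add: qf_diff_matrix)
qed

text \<open>Positivity needs no matrix inequality for second moments: by the first claim the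
  quadratic form is an expectation of squared D^{-1}-norms.\<close>

lemma
  assumes D: "spd D"
  shows sketch_variance: "(\<integral>T. qf (matrix_inv D) (T *v (D *v y) - D *v y) \<partial>S)
      = qf (D ** (\<integral>T. T ** matrix_inv D ** T \<partial>S) ** D - D) y"
    and psd_sketch_variance: "psd (D ** (\<integral>T. T ** matrix_inv D ** T \<partial>S) ** D - D)"
proof -
  let ?P = "matrix_inv D"
  have sym: "sym_mat D" and inv: "invertible D" and P: "sym_mat ?P"
    using D spd_matrix_inv[OF D] by (auto simp: spd_def invertible_spd)
  have "qf ?P (D *v y) = qf D y" for y
    by (simp add: qf_def matrix_inv_cancel inv inner_commute)
  then show *: "(\<integral>T. qf ?P (T *v (D *v y) - D *v y) \<partial>S)
      = qf (D ** (\<integral>T. T ** ?P ** T \<partial>S) ** D - D) y" for y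
    by (simp add: integral_qf_centered[OF P] qf_diff_matrix qf_mult_sym[OF sym])
  have "0 \<le> qf ?P y" for y
    using spd_imp_psd[OF spd_matrix_inv[OF D]] by (simp add: psd_def)
  then show "psd (D ** (\<integral>T. T ** ?P ** T \<partial>S) ** D - D)"
    unfolding psd_def *[symmetric]
    by (auto intro!: sym_mat_diff sym_mat_mult sym sym_mat_second_moment P)
qed

end

section \<open>Lyapunov analysis of det-CGD2-VR\<close>

text \<open>The state at time \<open>k\<close> reads only rounds before \<open>k\<close>, so
  overwriting round K leaves the states up to time K untouched. This allows round K to be integrated
  separately.\<close>

lemma dcgd_state_cong:
  "(\<And>j. j < k \<Longrightarrow> \<omega> j = \<omega>' j) \<Longrightarrow> dcgd_state n gr D x0 \<omega> k = dcgd_state n gr D x0 \<omega>' k"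
  by (induction k) (simp_all add: less_Suc_eq)

locale det_cgd2_vr = sketch S for S :: "'d::finite mat measure" +
  fixes n :: nat and fs :: "nat \<Rightarrow> real^'d \<Rightarrow> real" and gr :: "nat \<Rightarrow> real^'d \<Rightarrow> real^'d"
    and Ls :: "nat \<Rightarrow> 'd mat" and L D :: "'d mat" and p fstar :: real
  assumes n: "n \<ge> 1"
    and grad: "\<And>i x. i < n \<Longrightarrow> (fs i has_derivative (\<lambda>h. gr i x \<bullet> h)) (at x)"
    and cont: "\<And>i. i < n \<Longrightarrow> continuous_on UNIV (gr i)"
    and lower: "\<And>x. (1 / real n) * (\<Sum>i<n. fs i x) \<ge> fstar"
    and Ls_spd: "\<And>i. i < n \<Longrightarrow> spd (Ls i)"
    and L_spd: "spd L"
    and lip_i: "\<And>i. i < n \<Longrightarrow> lip_grad (gr i) (Ls i)"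
    and lip: "lip_grad (avg_grad n gr) L"
    and p: "0 < p" "p \<le> 1"
    and D_spd: "spd D"
    and step: "loewner_ge (matrix_inv D)
       (((1 - p) * ((1 / real n) * (\<Sum>i<n.
            lambda_max (D ** (\<integral>T. T ** matrix_inv D ** T \<partial>S) ** D - D)
          * lambda_max (Ls i)
          * lambda_max (matrix_inv (msqrt L) ** Ls i ** matrix_inv (msqrt L))))
          / (real n * p) + 1) *\<^sub>R L)"
begin

abbreviation F :: "real^'d \<Rightarrow> real^'d" where
  "F \<equiv> avg_grad n gr"

definition f :: "real^'d \<Rightarrow> real" where
  "f x = (1 / real n) * (\<Sum>i<n. fs i x)"

abbreviation P :: "'d mat" where
  "P \<equiv> matrix_inv D"

definition R :: real where
  "R = (1 / real n) * (\<Sum>i<n. lambda_max (D ** (\<integral>T. T ** P ** T \<partial>S) ** D - D)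
     * lambda_max (Ls i) * lambda_max (matrix_inv (msqrt L) ** Ls i ** matrix_inv (msqrt L)))"

text \<open>The estimator update cut out of the recursion, so that it can be integrated over one
  round with \<open>x\<close> and \<open>g\<close> fixed.\<close>

definition next_g :: "real^'d \<Rightarrow> real^'d \<Rightarrow> bool \<times> (nat \<Rightarrow> 'd mat) \<Rightarrow> real^'d" where
  "next_g x g y = (1 / real n) *\<^sub>R (\<Sum>i<n. if fst y then D *v gr i (x - g)
     else g + (snd y i ** D) *v (gr i (x - g) - gr i x))"

text \<open>The weight a of the squared error solves a (1 - p) + 1/2 = a: the share surviving a
  round plus the 1/2 charged by smoothness.\<close>

definition lyapunov :: "real^'d \<Rightarrow> real^'d \<Rightarrow> real" where
  "lyapunov x g = f x - fstar + qf P (g - D *v F x) / (2 * p)"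

lemma qf_nonneg: "0 \<le> qf D x" "0 \<le> qf P x" "0 \<le> qf L x"
  using spd_imp_psd[OF D_spd] spd_imp_psd[OF spd_matrix_inv[OF D_spd]] spd_imp_psd[OF L_spd]
  by (simp_all add: psd_def)

lemma f_has_derivative: "(f has_derivative (\<lambda>h. F x \<bullet> h)) (at x)"
proof -
  have "((\<lambda>x. (1 / real n) * (\<Sum>i<n. fs i x)) has_derivative
      (\<lambda>h. (1 / real n) * (\<Sum>i<n. gr i x \<bullet> h))) (at x)"
    by (intro has_derivative_mult_right has_derivative_sum grad) simp
  then show ?thesis
    by (simp add: f_def[abs_def] avg_grad_def inner_sum_left)
qed

lemma f_measurable [measurable]: "f \<in> borel_measurable borel"
  using f_has_derivative
  by (intro borel_measurable_continuous_onI continuous_at_imp_continuous_on)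
    (blast intro: has_derivative_continuous)

lemma gr_measurable: "i < n \<Longrightarrow> gr i \<in> borel_measurable borel"
  using cont by (rule borel_measurable_continuous_onI)

lemma F_measurable [measurable]: "F \<in> borel_measurable borel"
  unfolding avg_grad_def[abs_def]
  by (intro borel_measurable_scaleR borel_measurable_const borel_measurable_sum) (simp add: gr_measurable)

lemma lyapunov_measurable [measurable]:
  assumes [measurable]: "X \<in> borel_measurable M" "G \<in> borel_measurable M"
  shows "(\<lambda>\<omega>. lyapunov (X \<omega>) (G \<omega>)) \<in> borel_measurable M"
  unfolding lyapunov_def by measurable

text \<open>State and randomness may both vary: this serves a single round with frozen state as well
  as the whole run.\<close>

lemma next_g_measurable:
  assumes [measurable]: "X \<in> borel_measurable M" "G \<in> borel_measurable M"
    "Measurable.pred M (\<lambda>\<omega>. fst (Y \<omega>))"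
    and T: "\<And>i. i < n \<Longrightarrow> (\<lambda>\<omega>. snd (Y \<omega>) i) \<in> borel_measurable M"
  shows "(\<lambda>\<omega>. next_g (X \<omega>) (G \<omega>) (Y \<omega>)) \<in> borel_measurable M"
  unfolding next_g_def
proof (intro borel_measurable_scaleR borel_measurable_const borel_measurable_sum)
  fix i assume "i \<in> {..<n}"
  then have [measurable]: "gr i \<in> borel_measurable borel" "(\<lambda>\<omega>. snd (Y \<omega>) i) \<in> borel_measurable M"
    using gr_measurable T by auto
  show "(\<lambda>\<omega>. if fst (Y \<omega>) then D *v gr i (X \<omega> - G \<omega>)
      else G \<omega> + (snd (Y \<omega>) i ** D) *v (gr i (X \<omega> - G \<omega>) - gr i (X \<omega>))) \<in> borel_measurable M"
    by measurable
qed

section \<open>Expected decrease in one round\<close>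

abbreviation round_space :: "(bool \<times> (nat \<Rightarrow> 'd mat)) measure" where
  "round_space \<equiv> measure_pmf (bernoulli_pmf p) \<Otimes>\<^sub>M (\<Pi>\<^sub>M i\<in>{..<n}. S)"

lemma prob_space_sketches: "prob_space (\<Pi>\<^sub>M i\<in>{..<n}. S)"
  by (rule prob_space_PiM) (rule prob_space_axioms)

lemma prob_space_round: "prob_space round_space"
  by (intro prob_space_pair prob_space_sketches measure_pmf.prob_space_axioms)

lemma round_measurable:
  "Measurable.pred round_space (\<lambda>y. fst y)"
  "i < n \<Longrightarrow> (\<lambda>y. snd y i) \<in> borel_measurable round_space"
proof -
  show "Measurable.pred round_space (\<lambda>y. fst y)"
    by measurable
  assume "i < n"
  then have "(\<lambda>y. snd y i) \<in> measurable round_space S"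
    by (intro measurable_compose[OF measurable_snd measurable_component_singleton]) simp
  then show "(\<lambda>y. snd y i) \<in> borel_measurable round_space"
    by (simp add: measurable_cong_sets[OF refl sets_S])
qed

text \<open>One factor per change of norm. With y the gradient difference, the first passes from the
  variance form to |y|^2 and the second to the L_i^{-1}-norm of y; the Lipschitz bound turns this
  into the L_i-norm of g, and the third passes to the L-norm.\<close>

lemma sketch_variance_bound:
  assumes "i < n"
  shows "(\<integral>T. qf P (T *v (D *v (gr i (x - g) - gr i x)) - D *v (gr i (x - g) - gr i x)) \<partial>S)
    \<le> lambda_max (D ** (\<integral>T. T ** P ** T \<partial>S) ** D - D) * lambda_max (Ls i)
      * lambda_max (matrix_inv (msqrt L) ** Ls i ** matrix_inv (msqrt L)) * qf L g" (is "_ \<le> ?a * ?b * ?c * _")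
proof -
  let ?y = "gr i (x - g) - gr i x"
  note spd = Ls_spd[OF assms]
  have a: "0 \<le> ?a" "psd (D ** (\<integral>T. T ** P ** T \<partial>S) ** D - D)"
    using psd_sketch_variance[OF D_spd] lambda_max_nonneg by auto
  have b: "0 \<le> ?b"
    using spd by (intro lambda_max_nonneg spd_imp_psd)
  have "qf (matrix_inv (Ls i)) ?y \<le> qf (Ls i) g"
    using lip_i[OF assms] by (auto simp: lip_grad_def mnorm_def dest: spec2[of _ "x - g" x])
  also have "\<dots> \<le> ?c * qf L g"
    using spd by (intro qf_le_relative_lambda_max L_spd) (simp add: spd_def)
  finally have c: "qf (matrix_inv (Ls i)) ?y \<le> ?c * qf L g" .
  have "(\<integral>T. qf P (T *v (D *v ?y) - D *v ?y) \<partial>S) \<le> ?a * (norm ?y)\<^sup>2"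
    unfolding sketch_variance[OF D_spd] using a(2) by (intro qf_le_lambda_max) (simp add: psd_def)
  also have "\<dots> \<le> ?a * (?b * qf (matrix_inv (Ls i)) ?y)"
    by (intro mult_left_mono norm_le_lambda_max_qf_inv spd a)
  also have "\<dots> \<le> ?a * (?b * (?c * qf L g))"
    by (intro mult_left_mono a b c)
  finally show ?thesis by (simp add: mult_ac)
qed

lemma D_avg_grad: "D *v F y = (1 / real n) *\<^sub>R (\<Sum>i<n. D *v gr i y)"
  by (simp add: avg_grad_def matrix_vector_mult_scaleR linear_sum[OF matrix_vector_mul_linear] o_def)

lemma next_g_error_full:
  "next_g x g (True, T) - D *v F (x - g) = 0"
  by (simp add: next_g_def D_avg_grad)

text \<open>The target \<open>D *v F x\<close> moves by the average of the D-scaled gradient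
  differences, the estimator by the average of their sketches; only the centered discrepancies are
  added to the old error.\<close>

lemma next_g_error_compressed:
  "next_g x g (False, T) - D *v F (x - g) = (g - D *v F x)
     + (\<Sum>i<n. (1 / real n) *\<^sub>R (T i *v (D *v (gr i (x - g) - gr i x)) - D *v (gr i (x - g) - gr i x)))"
proof -
  have "next_g x g (False, T)
      = g + (1 / real n) *\<^sub>R (\<Sum>i<n. T i *v (D *v (gr i (x - g) - gr i x)))"
    using n by (simp add: next_g_def sum.distrib scaleR_add_right matrix_vector_mul_assoc sum_constant_scaleR
        del: sum_constant)
  then show ?thesis
    by (simp add: D_avg_grad sum_subtractf scaleR_diff_right matrix_vector_mult_diff_distrib flip: scaleR_sum_right)
qed

lemma variance_recursion:
  "(\<integral>\<^sup>+y. ennreal (qf P (next_g x g y - D *v F (x - g))) \<partial>round_space)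
    \<le> ennreal ((1 - p) * (qf P (g - D *v F x) + R / real n * qf L g))"
proof -
  define z where "z i = D *v (gr i (x - g) - gr i x)" for i
  interpret sk: prob_space "\<Pi>\<^sub>M i\<in>{..<n}. S"
    by (rule prob_space_sketches)
  have [measurable]: "(\<lambda>y. next_g x g y) \<in> borel_measurable round_space"
    by (intro next_g_measurable round_measurable) auto
  have psdP: "psd P"
    by (intro spd_imp_psd spd_matrix_inv D_spd)
  have var: "(\<integral>T. qf P ((1 / real n) *\<^sub>R (T *v z i - z i)) \<partial>S)
      = (1 / real n)\<^sup>2 * (\<integral>T. qf P (T *v z i - z i) \<partial>S)" for i
    unfolding qf_scaleR by simp
  have "(\<integral>\<^sup>+T. ennreal (qf P (next_g x g (False, T) - D *v F (x - g))) \<partial>(\<Pi>\<^sub>M i\<in>{..<n}. S))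
      = ennreal (qf P (g - D *v F x) + (\<Sum>i<n. \<integral>T. qf P ((1 / real n) *\<^sub>R (T *v z i - z i)) \<partial>S))"
    unfolding next_g_error_compressed z_def[symmetric]
  proof (intro nn_integral_qf_sum_indep prob_space_axioms psdP)
    fix i
    show "integrable S (\<lambda>T. (1 / real n) *\<^sub>R (T *v z i - z i))"
      by (intro integrable_scaleR_right integrable_centered)
    show "(\<integral>T. (1 / real n) *\<^sub>R (T *v z i - z i) \<partial>S) = 0"
      by (simp only: integral_scaleR_right integral_centered scaleR_zero_right)
    show "integrable S (\<lambda>T. (norm ((1 / real n) *\<^sub>R (T *v z i - z i)))\<^sup>2)"
      unfolding norm_scaleR power_mult_distrib by (intro integrable_mult_right integrable_sq_centered)
  qed simp
  also have "\<dots> \<le> ennreal (qf P (g - D *v F x) + R / real n * qf L g)"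
  proof (intro ennreal_leI add_left_mono)
    have "(\<Sum>i<n. \<integral>T. qf P ((1 / real n) *\<^sub>R (T *v z i - z i)) \<partial>S)
        \<le> (\<Sum>i<n. (1 / real n)\<^sup>2 * (lambda_max (D ** (\<integral>T. T ** P ** T \<partial>S) ** D - D) * lambda_max (Ls i)
          * lambda_max (matrix_inv (msqrt L) ** Ls i ** matrix_inv (msqrt L)) * qf L g))"
      unfolding var unfolding z_def by (intro sum_mono mult_left_mono sketch_variance_bound) auto
    \<comment> \<open>Of the two factors 1/n from squaring the average, one is the average inside
      \<open>R\<close> and the other remains.\<close>
    also have "\<dots> = R / real n * qf L g"
      by (simp add: R_def sum_distrib_left sum_distrib_right sum_divide_distrib power2_eq_square mult_ac)
    finally show "(\<Sum>i<n. \<integral>T. qf P ((1 / real n) *\<^sub>R (T *v z i - z i)) \<partial>S) \<le> R / real n * qf L g" .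
  qed
  finally have compressed: "(\<integral>\<^sup>+T. ennreal (qf P (next_g x g (False, T) - D *v F (x - g))) \<partial>(\<Pi>\<^sub>M i\<in>{..<n}. S))
      \<le> ennreal (qf P (g - D *v F x) + R / real n * qf L g)" .
  have "(\<integral>\<^sup>+y. ennreal (qf P (next_g x g y - D *v F (x - g))) \<partial>round_space)
      = (\<integral>\<^sup>+c. \<integral>\<^sup>+T. ennreal (qf P (next_g x g (c, T) - D *v F (x - g))) \<partial>(\<Pi>\<^sub>M i\<in>{..<n}. S)
          \<partial>measure_pmf (bernoulli_pmf p))"
    by (rule sk.nn_integral_fst[symmetric]) measurable
  \<comment> \<open>The full-gradient branch has error 0, so only the branch of weight 1 - p
    survives.\<close>
  also have "\<dots> = (\<integral>\<^sup>+T. ennreal (qf P (next_g x g (False, T) - D *v F (x - g))) \<partial>(\<Pi>\<^sub>M i\<in>{..<n}. S))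
      * ennreal (1 - p)"
    using p by (simp add: next_g_error_full ennreal_minus)
  also have "\<dots> \<le> ennreal (qf P (g - D *v F x) + R / real n * qf L g) * ennreal (1 - p)"
    by (intro mult_right_mono compressed) simp
  also have "\<dots> = ennreal ((1 - p) * (qf P (g - D *v F x) + R / real n * qf L g))"
    using p by (simp add: mult.commute ennreal_mult')
  finally show ?thesis .
qed

lemma lyapunov_decrease:
  "(\<integral>\<^sup>+y. ennreal (lyapunov (x - g) (next_g x g y)) \<partial>round_space) + ennreal (qf D (F x) / 2)
    \<le> ennreal (lyapunov x g)"
proof -
  interpret rd: prob_space round_space
    by (rule prob_space_round)
  have [measurable]: "(\<lambda>y. next_g x g y) \<in> borel_measurable round_space"
    by (intro next_g_measurable round_measurable) auto
  define V where "V = qf P (g - D *v F x)"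
  \<comment> \<open>The excess over 1 in the step-size condition; half of it is the coefficient of
    \<open>qf L g\<close> that the sketch variance produces through the weight 1/(2p).\<close>
  define \<kappa> where "\<kappa> = (1 - p) * R / (real n * p)"
  \<comment> \<open>Nonnegativity lets the real bounds be merged inside
    \<open>ennreal\<close>.\<close>
  have R: "0 \<le> R"
    unfolding R_def
  proof (intro mult_nonneg_nonneg sum_nonneg)
    fix i assume "i \<in> {..<n}"
    then have psd: "psd (Ls i)"
      by (auto intro: spd_imp_psd Ls_spd)
    have "sym_mat (matrix_inv (msqrt L))"
      using spd_matrix_inv[OF msqrt_spd(1)[OF L_spd]] by (simp add: spd_def)
    with psd show "0 \<le> lambda_max (matrix_inv (msqrt L) ** Ls i ** matrix_inv (msqrt L))"
      by (intro lambda_max_nonneg psd_congruence)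
    show "0 \<le> lambda_max (Ls i)" "0 \<le> lambda_max (D ** (\<integral>T. T ** P ** T \<partial>S) ** D - D)"
      using psd psd_sketch_variance[OF D_spd] by (auto intro: lambda_max_nonneg)
  qed simp
  have fx: "0 \<le> f (x - g) - fstar"
    using lower[of "x - g"] by (simp add: f_def)
  have "(\<integral>\<^sup>+y. ennreal (lyapunov (x - g) (next_g x g y)) \<partial>round_space)
      = (\<integral>\<^sup>+y. ennreal (f (x - g) - fstar)
          + ennreal (1 / (2 * p)) * ennreal (qf P (next_g x g y - D *v F (x - g))) \<partial>round_space)"
    using p fx qf_nonneg by (simp add: lyapunov_def flip: ennreal_plus ennreal_mult)
  also have "\<dots> = ennreal (f (x - g) - fstar) + ennreal (1 / (2 * p))
      * (\<integral>\<^sup>+y. ennreal (qf P (next_g x g y - D *v F (x - g))) \<partial>round_space)"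
    by (subst nn_integral_add) (auto simp: nn_integral_cmult rd.emeasure_space_1)
  also have "\<dots> \<le> ennreal (f (x - g) - fstar)
      + ennreal (1 / (2 * p)) * ennreal ((1 - p) * (V + R / real n * qf L g))"
    unfolding V_def by (intro add_left_mono mult_left_mono variance_recursion) simp
  also have "\<dots> = ennreal (f (x - g) - fstar + (1 - p) * (V + R / real n * qf L g) / (2 * p))"
    using p fx R qf_nonneg by (simp add: V_def flip: ennreal_plus ennreal_mult)
  finally have le: "(\<integral>\<^sup>+y. ennreal (lyapunov (x - g) (next_g x g y)) \<partial>round_space)
      \<le> ennreal (f (x - g) - fstar + (1 - p) * (V + R / real n * qf L g) / (2 * p))" .
  have "f (x - g) \<le> f x - F x \<bullet> g + qf L g / 2"
    by (rule lip_grad_descent[OF L_spd lip f_has_derivative])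
  moreover have "V = qf P g - 2 * (F x \<bullet> g) + qf D (F x)"
  proof -
    have symP: "sym_mat P" and inv: "invertible D"
      using spd_matrix_inv[OF D_spd] invertible_spd[OF D_spd] by (auto simp: spd_def)
    have "V = qf P (g + - (D *v F x))"
      by (simp add: V_def)
    also have "\<dots> = qf P g - 2 * ((P *v g) \<bullet> (D *v F x)) + qf P (D *v F x)"
      unfolding qf_add[OF symP] by simp
    also have "(P *v g) \<bullet> (D *v F x) = F x \<bullet> g"
      by (simp add: matrix_inv_cancel[OF inv] inner_commute flip: sym_mat_inner[OF symP])
    also have "qf P (D *v F x) = qf D (F x)"
      by (simp add: qf_def matrix_inv_cancel[OF inv] inner_commute)
    finally show ?thesis .
  qed
  moreover have "(\<kappa> + 1) * qf L g \<le> qf P g"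
    using step unfolding loewner_ge_def psd_def qf_diff_matrix qf_scaleR_matrix R_def[symmetric]
    by (simp add: \<kappa>_def)
  ultimately have "f (x - g) + qf D (F x) / 2 + \<kappa> * qf L g / 2 \<le> f x + V / 2"
    by (simp add: algebra_simps)
  \<comment> \<open>Here (1 - p)/(2p) = 1/(2p) - 1/2, and the term -V/2 cancels the V/2 of the
    smoothness estimate.\<close>
  moreover have "(1 - p) * (V + R / real n * qf L g) / (2 * p) = V / (2 * p) - V / 2 + \<kappa> * qf L g / 2"
    using p n by (simp add: \<kappa>_def field_simps)
  ultimately have "f (x - g) - fstar + (1 - p) * (V + R / real n * qf L g) / (2 * p) + qf D (F x) / 2
      \<le> lyapunov x g"
    by (simp add: lyapunov_def V_def)
  moreover have "0 \<le> (1 - p) * (V + R / real n * qf L g) / (2 * p)"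
    using p R qf_nonneg by (simp add: V_def)
  ultimately show ?thesis
    using add_right_mono[OF le, of "ennreal (qf D (F x) / 2)"] fx qf_nonneg
    by (smt (verit, best) ennreal_leI ennreal_plus half_gt_zero_iff order_trans divide_nonneg_pos)
qed

section \<open>The whole run: measurability and telescoping\<close>

lemma dcgd_state_Suc:
  "dcgd_state n gr D x0 \<omega> (Suc k) =
    (let (x, g) = dcgd_state n gr D x0 \<omega> k in (x - g, next_g x g (\<omega> k)))"
  by (simp add: next_g_def Let_def split: prod.split)

declare dcgd_state.simps(2) [simp del]

lemma dcgd_space_eq: "dcgd_space n p S K = (\<Pi>\<^sub>M k\<in>{..<K}. round_space)"
  by (simp add: dcgd_space_def)

text \<open>For \<open>k \<ge> K\<close> the coordinate \<open>\<omega> k\<close> is the constant \<open>undefined\<close>, which need not lie in the space of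
  \<open>round_space\<close>.\<close>
lemma dcgd_coordinate_measurable:
  "Measurable.pred (dcgd_space n p S K) (\<lambda>\<omega>. fst (\<omega> k))"
  "i < n \<Longrightarrow> (\<lambda>\<omega>. snd (\<omega> k) i) \<in> borel_measurable (dcgd_space n p S K)"
proof -
  have *: "(\<lambda>\<omega>. h (\<omega> k)) \<in> measurable (dcgd_space n p S K) N"
    if "h \<in> measurable round_space N" "h undefined \<in> space N"
    for N :: "'c measure" and h :: "bool \<times> (nat \<Rightarrow> 'd mat) \<Rightarrow> 'c"
  proof (cases "k < K")
    case True
    then show ?thesis
      unfolding dcgd_space_eq
      by (intro measurable_compose[OF _ that(1)] measurable_component_singleton) simp
  next
    case False
    then have "(\<lambda>\<omega>. h (\<omega> k)) \<in> measurable (dcgd_space n p S K) N \<longleftrightarrow>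
        (\<lambda>\<omega>. h undefined) \<in> measurable (dcgd_space n p S K) N"
      by (intro measurable_cong) (auto simp: dcgd_space_eq space_PiM PiE_def extensional_def)
    then show ?thesis
      using that(2) by simp
  qed
  show "Measurable.pred (dcgd_space n p S K) (\<lambda>\<omega>. fst (\<omega> k))"
    by (rule *[OF round_measurable(1)]) simp
  show "(\<lambda>\<omega>. snd (\<omega> k) i) \<in> borel_measurable (dcgd_space n p S K)" if "i < n"
    by (rule *[OF round_measurable(2)[OF that]]) simp
qed

text \<open>\<open>k\<close> is not bounded by the horizon, because the random output index later
  ranges over all of \<open>nat\<close> as a measurable space.\<close>

lemma dcgd_state_measurable [measurable]:
  "(\<lambda>\<omega>. fst (dcgd_state n gr D x0 \<omega> k)) \<in> borel_measurable (dcgd_space n p S K)"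
  "(\<lambda>\<omega>. snd (dcgd_state n gr D x0 \<omega> k)) \<in> borel_measurable (dcgd_space n p S K)"
proof (induction k)
  case (Suc k)
  note [measurable] = Suc
  have "(\<lambda>\<omega>. next_g (fst (dcgd_state n gr D x0 \<omega> k)) (snd (dcgd_state n gr D x0 \<omega> k)) (\<omega> k))
      \<in> borel_measurable (dcgd_space n p S K)"
    by (intro next_g_measurable Suc dcgd_coordinate_measurable)
  then show "(\<lambda>\<omega>. snd (dcgd_state n gr D x0 \<omega> (Suc k))) \<in> borel_measurable (dcgd_space n p S K)"
    by (simp add: dcgd_state_Suc case_prod_beta)
  have "(\<lambda>\<omega>. fst (dcgd_state n gr D x0 \<omega> k) - snd (dcgd_state n gr D x0 \<omega> k))
      \<in> borel_measurable (dcgd_space n p S K)"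
    by measurable
  then show "(\<lambda>\<omega>. fst (dcgd_state n gr D x0 \<omega> (Suc k))) \<in> borel_measurable (dcgd_space n p S K)"
    by (simp add: dcgd_state_Suc case_prod_beta)
qed simp_all

text \<open>The accumulated gradient terms share one integral with the final potential because the
  probability space itself grows with \<open>K\<close>. Induction splits off the newest coordinate
  and applies \<open>lyapunov_decrease\<close> to the inner integral.\<close>

lemma lyapunov_telescope:
  "(\<integral>\<^sup>+w. ennreal (case_prod lyapunov (dcgd_state n gr D x0 w K))
      + (\<Sum>k<K. ennreal (qf D (F (fst (dcgd_state n gr D x0 w k))) / 2)) \<partial>dcgd_space n p S K)
    \<le> ennreal (f x0 - fstar)"
proof (induction K)
  case 0
  \<comment> \<open>The empty product is a single point, and the initial estimator is exact, so the
    error term is 0.\<close>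
  show ?case
    by (simp add: dcgd_space_def PiM_empty nn_integral_count_space_finite lyapunov_def)
next
  case (Suc K)
  interpret rd: prob_space round_space
    by (rule prob_space_round)
  interpret product_prob_space "\<lambda>_. round_space" "{..<K}"
    by (rule product_prob_spaceI) (rule prob_space_round)
  let ?st = "dcgd_state n gr D x0"
  let ?G = "\<lambda>w k. ennreal (qf D (F (fst (?st w k))) / 2)"
  let ?\<Phi> = "\<lambda>s. ennreal (case_prod lyapunov s)"
  \<comment> \<open>The case \<open>k = K\<close> is included: the state at time K is determined
    before round K is drawn.\<close>
  have [simp]: "?st (w(K := y)) k = ?st w k" if "k \<le> K" for w y k
    using that by (intro dcgd_state_cong) auto
  have "(\<integral>\<^sup>+w. ?\<Phi> (?st w (Suc K)) + (\<Sum>k<Suc K. ?G w k) \<partial>dcgd_space n p S (Suc K))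
      = (\<integral>\<^sup>+w. \<integral>\<^sup>+y. ?\<Phi> (?st (w(K := y)) (Suc K)) + (\<Sum>k<Suc K. ?G (w(K := y)) k)
          \<partial>round_space \<partial>dcgd_space n p S K)"
    unfolding dcgd_space_eq lessThan_Suc[of K]
  proof (rule product_nn_integral_insert)
    show "(\<lambda>w. ?\<Phi> (?st w (Suc K)) + (\<Sum>k\<in>insert K {..<K}. ?G w k))
        \<in> borel_measurable (\<Pi>\<^sub>M k\<in>insert K {..<K}. round_space)"
      unfolding lessThan_Suc[symmetric] dcgd_space_eq[symmetric] case_prod_beta by measurable
  qed auto
  also have "\<dots> \<le> (\<integral>\<^sup>+w. ?\<Phi> (?st w K) + (\<Sum>k<K. ?G w k) \<partial>dcgd_space n p S K)"
  proof (intro nn_integral_mono)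
    fix w
    obtain x g where xg: "?st w K = (x, g)" by fastforce
    have [measurable]: "(\<lambda>y. next_g x g y) \<in> borel_measurable round_space"
      by (intro next_g_measurable round_measurable) auto
    have "(\<integral>\<^sup>+y. ?\<Phi> (?st (w(K := y)) (Suc K)) + (\<Sum>k<Suc K. ?G (w(K := y)) k) \<partial>round_space)
        = (\<integral>\<^sup>+y. ennreal (lyapunov (x - g) (next_g x g y)) + (\<Sum>k<Suc K. ?G w k) \<partial>round_space)"
      by (simp add: dcgd_state_Suc xg)
    also have "\<dots> = ((\<integral>\<^sup>+y. ennreal (lyapunov (x - g) (next_g x g y)) \<partial>round_space) + ennreal (qf D (F x) / 2))
        + (\<Sum>k<K. ?G w k)"
      by (subst nn_integral_add) (auto simp: rd.emeasure_space_1 xg add_ac)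
    also have "\<dots> \<le> ?\<Phi> (?st w K) + (\<Sum>k<K. ?G w k)"
      using lyapunov_decrease[of x g] by (simp add: xg add_right_mono)
    finally show "(\<integral>\<^sup>+y. ?\<Phi> (?st (w(K := y)) (Suc K)) + (\<Sum>k<Suc K. ?G (w(K := y)) k) \<partial>round_space)
        \<le> ?\<Phi> (?st w K) + (\<Sum>k<K. ?G w k)" .
  qed
  also have "\<dots> \<le> ennreal (f x0 - fstar)"
    by (rule Suc.IH)
  finally show ?case .
qed

section \<open>The uniformly drawn output iterate\<close>

lemma gradient_measurable [measurable]:
  "(\<lambda>(\<omega>, k). ennreal (qf D (F (fst (dcgd_state n gr D x0 \<omega> k)))))
    \<in> borel_measurable (dcgd_space n p S K \<Otimes>\<^sub>M measure_pmf q)"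
proof -
  have "(\<lambda>x. ennreal (qf D (F (fst (dcgd_state n gr D x0 (fst x) (snd x))))))
      \<in> borel_measurable (dcgd_space n p S K \<Otimes>\<^sub>M measure_pmf q)"
    \<comment> \<open>The index is discrete and countable, so joint measurability follows from
      measurability at each fixed \<open>k\<close>.\<close>
    by (rule measurable_compose_countable'[where g = snd and I = UNIV
          and f = "\<lambda>k x. ennreal (qf D (F (fst (dcgd_state n gr D x0 (fst x) k))))"])
      (auto intro!: measurable_compose[OF measurable_fst])
  then show ?thesis by (simp add: case_prod_beta)
qed

lemma expected_gradient_bound:
  assumes K: "K \<ge> 1"
  shows "(\<integral>\<^sup>+(\<omega>, k). ennreal (qf D (F (fst (dcgd_state n gr D x0 \<omega> k))))
      \<partial>(dcgd_space n p S K \<Otimes>\<^sub>M measure_pmf (pmf_of_set {..<K})))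
    \<le> ennreal (2 * (f x0 - fstar) / real K)"
proof -
  let ?g = "\<lambda>\<omega> k. qf D (F (fst (dcgd_state n gr D x0 \<omega> k)))"
  have K': "{..<K} \<noteq> {}"
    using K by (auto simp: lessThan_empty_iff)
  have fx0: "0 \<le> f x0 - fstar"
    using lower[of x0] by (simp add: f_def)
  have "(\<integral>\<^sup>+(\<omega>, k). ennreal (?g \<omega> k) \<partial>(dcgd_space n p S K \<Otimes>\<^sub>M measure_pmf (pmf_of_set {..<K})))
      = (\<integral>\<^sup>+\<omega>. \<integral>\<^sup>+k. ennreal (?g \<omega> k) \<partial>measure_pmf (pmf_of_set {..<K}) \<partial>dcgd_space n p S K)"
    using measure_pmf.nn_integral_fst[OF gradient_measurable] by simp
  \<comment> \<open>The uniform draw contributes 1/K; the 2 compensates the halves that match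
    \<open>lyapunov_telescope\<close>.\<close>
  also have "\<dots> = (\<integral>\<^sup>+\<omega>. ennreal (2 / real K) * (\<Sum>k<K. ennreal (?g \<omega> k / 2)) \<partial>dcgd_space n p S K)"
  proof (intro nn_integral_cong)
    fix \<omega> :: "nat \<Rightarrow> bool \<times> (nat \<Rightarrow> 'd mat)"
    have "(\<integral>\<^sup>+k. ennreal (?g \<omega> k) \<partial>measure_pmf (pmf_of_set {..<K})) = (\<Sum>k<K. ennreal (?g \<omega> k)) / real K"
      using K' by (simp add: nn_integral_pmf_of_set ennreal_of_nat_eq_real_of_nat)
    also have "\<dots> = ennreal ((\<Sum>k<K. ?g \<omega> k) / real K)"
      using K by (simp add: qf_nonneg sum_nonneg divide_ennreal)
    also have "\<dots> = ennreal (2 / real K) * (\<Sum>k<K. ennreal (?g \<omega> k / 2))"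
      by (simp add: qf_nonneg sum_nonneg flip: ennreal_mult sum_divide_distrib)
    finally show "(\<integral>\<^sup>+k. ennreal (?g \<omega> k) \<partial>measure_pmf (pmf_of_set {..<K}))
        = ennreal (2 / real K) * (\<Sum>k<K. ennreal (?g \<omega> k / 2))" .
  qed
  also have "\<dots> = ennreal (2 / real K) * (\<integral>\<^sup>+\<omega>. (\<Sum>k<K. ennreal (?g \<omega> k / 2)) \<partial>dcgd_space n p S K)"
    by (rule nn_integral_cmult) measurable
  also have "\<dots> \<le> ennreal (2 / real K) * ennreal (f x0 - fstar)"
  proof (intro mult_left_mono)
    \<comment> \<open>The final potential can be added freely, being nonnegative in
      \<open>ennreal\<close>.\<close>
    have "(\<integral>\<^sup>+\<omega>. (\<Sum>k<K. ennreal (?g \<omega> k / 2)) \<partial>dcgd_space n p S K)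
      \<le> (\<integral>\<^sup>+\<omega>. ennreal (case_prod lyapunov (dcgd_state n gr D x0 \<omega> K)) + (\<Sum>k<K. ennreal (?g \<omega> k / 2)) \<partial>dcgd_space n p S K)"
      by (intro nn_integral_mono) simp
    also have "\<dots> \<le> ennreal (f x0 - fstar)"
      by (rule lyapunov_telescope)
    finally show "(\<integral>\<^sup>+\<omega>. (\<Sum>k<K. ennreal (?g \<omega> k / 2)) \<partial>dcgd_space n p S K) \<le> ennreal (f x0 - fstar)" .
  qed simp
  also have "\<dots> = ennreal (2 * (f x0 - fstar) / real K)"
    using fx0 by (simp flip: ennreal_mult)
  finally show ?thesis .
qed

end

theorem theorem3:
  fixes n K :: nat and fs :: "nat \<Rightarrow> real^'d::finite \<Rightarrow> real"
    and gr :: "nat \<Rightarrow> real^'d \<Rightarrow> real^'d"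
    and Ls :: "nat \<Rightarrow> 'd mat" and L D :: "'d mat"
    and S :: "'d mat measure" and p fstar :: real and x0 :: "real^'d"
  assumes n: "n \<ge> 1"
    and grad: "\<And>i x. i < n \<Longrightarrow> (fs i has_derivative (\<lambda>h. gr i x \<bullet> h)) (at x)"
    and cont: "\<And>i. i < n \<Longrightarrow> continuous_on UNIV (gr i)"
    and lower: "\<And>x. (1 / real n) * (\<Sum>i<n. fs i x) \<ge> fstar"
    and Ls_spd: "\<And>i. i < n \<Longrightarrow> spd (Ls i)"
    and L_spd: "spd L"
    and lip_i: "\<And>i. i < n \<Longrightarrow> lip_grad (gr i) (Ls i)"
    and lip: "lip_grad (avg_grad n gr) L"
    and S_prob: "prob_space S"
    and S_sets: "sets S = sets borel"
    and S_psd: "AE T in S. psd T"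
    and S_mean: "integrable S (\<lambda>T. T)" "(\<integral>T. T \<partial>S) = mat 1"
    and S_second: "integrable S (\<lambda>T. (norm T)\<^sup>2)"
    and p: "0 < p" "p \<le> 1"
    and D_spd: "spd D"
    and step: "loewner_ge (matrix_inv D)
       (((1 - p) * ((1 / real n) * (\<Sum>i<n.
            lambda_max (D ** (\<integral>T. T ** matrix_inv D ** T \<partial>S) ** D - D)
          * lambda_max (Ls i)
          * lambda_max (matrix_inv (msqrt L) ** Ls i ** matrix_inv (msqrt L))))
          / (real n * p) + 1) *\<^sub>R L)"
    and K: "K \<ge> 1"
  shows "(\<integral>\<^sup>+ (\<omega>, k). ennreal
            (qf ((1 / det D powr (1 / real CARD('d))) *\<^sub>R D)
                (avg_grad n gr (fst (dcgd_state n gr D x0 \<omega> k))))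
          \<partial>(dcgd_space n p S K \<Otimes>\<^sub>M measure_pmf (pmf_of_set {..<K})))
     \<le> ennreal (2 * ((1 / real n) * (\<Sum>i<n. fs i x0) - fstar)
                 / (det D powr (1 / real CARD('d)) * real K))"
proof -
  interpret det_cgd2_vr S n fs gr Ls L D p fstar
    by (intro det_cgd2_vr.intro sketch.intro sketch_axioms.intro det_cgd2_vr_axioms.intro assms)
  \<comment> \<open>The determinant normalization is a nonnegative scalar that does not affect the
    trajectory, so it factors out of the integral.\<close>
  define c where "c = 1 / det D powr (1 / real CARD('d))"
  have c: "0 \<le> c"
    by (simp add: c_def)
  let ?M = "dcgd_space n p S K \<Otimes>\<^sub>M measure_pmf (pmf_of_set {..<K})"
  have "(\<integral>\<^sup>+ (\<omega>, k). ennreal (qf (c *\<^sub>R D) (avg_grad n gr (fst (dcgd_state n gr D x0 \<omega> k)))) \<partial>?M)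
      = (\<integral>\<^sup>+ x. ennreal c * (case x of (\<omega>, k) \<Rightarrow>
          ennreal (qf D (avg_grad n gr (fst (dcgd_state n gr D x0 \<omega> k))))) \<partial>?M)"
    using c by (intro nn_integral_cong) (simp add: qf_scaleR_matrix ennreal_mult' split: prod.split)
  also have "\<dots> = ennreal c * (\<integral>\<^sup>+ (\<omega>, k).
      ennreal (qf D (avg_grad n gr (fst (dcgd_state n gr D x0 \<omega> k)))) \<partial>?M)"
    by (rule nn_integral_cmult[OF gradient_measurable])
  also have "\<dots> \<le> ennreal c * ennreal (2 * (f x0 - fstar) / real K)"
    by (intro mult_left_mono expected_gradient_bound K) simp
  also have "\<dots> = ennreal (2 * ((1 / real n) * (\<Sum>i<n. fs i x0) - fstar)
      / (det D powr (1 / real CARD('d)) * real K))"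
    using c by (simp add: f_def c_def flip: ennreal_mult')
  finally show ?thesis
    by (simp add: c_def)
qed

end
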